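(* One has $$\rho\left(\mathbf{P}^{-1/2}\mathcal{S}(\mathbf{A})\mathbf{P}^{-1/2}\right)\le\varsigma,\qquad\text{where}\qquad \varsigma=\frac32\max_{1\le i\le3}\tan\left(\frac{\delta_i}{2}\pi\right)\frac{|k_{i,+}-k_{i,-}|}{k_{i,+}+k_{i,-}}\ge0 ,$$ and $\rho(\cdot)$ denotes the spectral radius.
   Context: Data: $\alpha,\beta,\gamma\in(0,1)$, also written $\delta_1=\alpha,\ \delta_2=\beta,\ \delta_3=\gamma$; real numbers $a_i<b_i$ and positive constants $k_{i,+},k_{i,-}>0$ for $i=1,2,3$; $T>0$; positive integers $M,n_1,n_2,n_3$; $\Delta t=T/M$, $h_i=(b_i-a_i)/(n_i+1)$, $N=n_1n_2n_3$, and $\eta_{\delta_i}=\frac{\Delta t}{2\Gamma(\delta_i+1)h_i^{2-\delta_i}}$, i.e. $\eta_\alpha,\eta_\beta,\eta_\gamma$ for $i=1,2,3$. For $\delta\in(0,1)$ set $s_0^{(\delta)}=(\tfrac12)^\delta$, $s_1^{(\delta)}=(\tfrac32)^\delta-2(\tfrac12)^\delta$, $s_k^{(\delta)}=(k+\tfrac12)^\delta-2(k-\tfrac12)^\delta+(k-\tfrac32)^\delta$ for $k\ge2$; $q_0^{(\delta)}=-s_0^{(\delta)}$ and $q_k^{(\delta)}=s_{k-1}^{(\delta)}-s_k^{(\delta)}$ for $k\ge1$. $\mathbf{T}_{n}^{\delta}\in\mathbb{R}^{n\times n}$ is the lower Hessenberg Toeplitz matrix with $(j,k)$ entry $q_{j-k+1}^{(\delta)}$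 if $j-k+1\ge0$ and $0$ otherwise. $\mathbf{A}_n\in\mathbb{R}^{n\times n}$ is the symmetric tridiagonal Toeplitz matrix with diagonal entries $6/8$ and sub-/superdiagonal entries $1/8$. $\mathbf{B}_{n_i}^{\delta_i}=k_{i,+}\mathbf{T}_{n_i}^{\delta_i}+k_{i,-}(\mathbf{T}_{n_i}^{\delta_i})^{\top}$. For a real square matrix $\mathbf{Z}$, $\mathcal{H}(\mathbf{Z})=(\mathbf{Z}+\mathbf{Z}^\top)/2$ and $\mathcal{S}(\mathbf{Z})=(\mathbf{Z}-\mathbf{Z}^\top)/2$. For a real symmetric Toeplitz matrix $T_n=[t_{|j-k|}]_{j,k=1}^n$, its $\tau$ matrix is $\tau(T_n)=\mathbf{S}_n\,\mathrm{diag}(\lambda_1,\dots,\lambda_n)\,\mathbf{S}_n$, where $[\mathbf{S}_n]_{j,k}=\sqrt{\frac{2}{n+1}}\sin\left(\frac{jk\pi}{n+1}\right)$ and $\lambda_k=t_0+2\sum_{j=1}^{n-1}t_j\cos\left(\frac{jk\pi}{n+1}\right)$. With $\otimes$ the Kronecker product, $$\mathbf{A}=\mathbf{A}_{n_3}\otimes\mathbf{A}_{n_2}\otimes\mathbf{A}_{n_1}+\eta_\alpha\,\mathbf{A}_{n_3}\otimes\mathbf{A}_{n_2}\otimes\mathbf{B}_{n_1}^{\alpha}+\eta_\beta\,\mathbf{A}_{n_3}\otimes\mathbf{B}_{n_2}^{\beta}\otimes\mathbf{A}_{n_1}+\eta_\gamma\,\mathbf{B}_{n_3}^{\gamma}\otimes\mathbf{A}_{n_2}\otimes\mathbf{A}_{n_1},$$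 $$\mathbf{P}=\mathbf{A}_{n_3}\otimes\mathbf{A}_{n_2}\otimes\mathbf{A}_{n_1}+\eta_\alpha\,\mathbf{A}_{n_3}\otimes\mathbf{A}_{n_2}\otimes\tau(\mathcal{H}(\mathbf{B}_{n_1}^{\alpha}))+\eta_\beta\,\mathbf{A}_{n_3}\otimes\tau(\mathcal{H}(\mathbf{B}_{n_2}^{\beta}))\otimes\mathbf{A}_{n_1}+\eta_\gamma\,\tau(\mathcal{H}(\mathbf{B}_{n_3}^{\gamma}))\otimes\mathbf{A}_{n_2}\otimes\mathbf{A}_{n_1}.$$ $\mathbf{P}$ is symmetric positive definite and $\mathbf{P}^{-1/2}$ is the inverse of its symmetric positive definite square root. *)

theory Defs
  imports
    "HOL-Analysis.Gamma_Function"
    "Jordan_Normal_Form.Spectral_Radius"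
    "Jordan_Normal_Form.Gauss_Jordan_Elimination"
begin

text \<open>
  Matrices are those of Jordan_Normal_Form, hence indexed from 0. Data carrying
  an index i = 1, 2, 3 are functions on nat; only their values at 1, 2, 3 are used. In
  particular \<delta> 1, \<delta> 2, \<delta> 3 are the orders \<alpha>, \<beta>, \<gamma>.
\<close>

definition s_coeff :: "real \<Rightarrow> nat \<Rightarrow> real" where
  "s_coeff d k =
    (if k = 0 then (1/2) powr d
     else if k = 1 then (3/2) powr d - 2 * (1/2) powr d
     else (real k + 1/2) powr d - 2 * (real k - 1/2) powr d + (real k - 3/2) powr d)"

definition q_coeff :: "real \<Rightarrow> nat \<Rightarrow> real" where
  "q_coeff d k = (if k = 0 then - s_coeff d 0 else s_coeff d (k - 1) - s_coeff d k)"

text \<open>The guard k \<le> j + 1 makes the subtraction on nat exact.\<close>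

definition T_mat :: "real \<Rightarrow> nat \<Rightarrow> real mat" where
  "T_mat d n = Matrix.mat n n (\<lambda>(j, k). if k \<le> j + 1 then q_coeff d (j + 1 - k) else 0)"

definition A_mat :: "nat \<Rightarrow> real mat" where
  "A_mat n = Matrix.mat n n
    (\<lambda>(j, k). if j = k then 6/8 else if j = k + 1 \<or> k = j + 1 then 1/8 else 0)"

definition B_mat :: "real \<Rightarrow> real \<Rightarrow> real \<Rightarrow> nat \<Rightarrow> real mat" where
  "B_mat kp km d n = kp \<cdot>\<^sub>m T_mat d n + km \<cdot>\<^sub>m transpose_mat (T_mat d n)"

definition sym_part :: "real mat \<Rightarrow> real mat" where
  "sym_part Z = (1/2) \<cdot>\<^sub>m (Z + transpose_mat Z)"

definition skew_part :: "real mat \<Rightarrow> real mat" where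
  "skew_part Z = (1/2) \<cdot>\<^sub>m (Z - transpose_mat Z)"

definition sine_mat :: "nat \<Rightarrow> real mat" where
  "sine_mat n = Matrix.mat n n
    (\<lambda>(j, k). sqrt (2 / (real n + 1)) * sin (real (j + 1) * real (k + 1) * pi / (real n + 1)))"

text \<open>
  Meaningful for a symmetric Toeplitz matrix X only; the Toeplitz entries t 0, t 1, ... are
  read off the first column, and the diagonal entry with 0-based index k is the
  eigenvalue numbered k + 1.
\<close>

definition tau_mat :: "real mat \<Rightarrow> real mat" where
  "tau_mat X =
    (let n = dim_row X in
      sine_mat n *
      mat_diag n (\<lambda>k. X $$ (0, 0) +
        2 * (\<Sum>j = 1..n - 1. X $$ (j, 0) * cos (real j * real (k + 1) * pi / (real n + 1)))) *
      sine_mat n)"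

definition kron :: "real mat \<Rightarrow> real mat \<Rightarrow> real mat"  (infixl "\<otimes>\<^sub>K" 75) where
  "X \<otimes>\<^sub>K Y = Matrix.mat (dim_row X * dim_row Y) (dim_col X * dim_col Y)
    (\<lambda>(i, j). X $$ (i div dim_row Y, j div dim_col Y) * Y $$ (i mod dim_row Y, j mod dim_col Y))"

definition step_size :: "(nat \<Rightarrow> real) \<Rightarrow> (nat \<Rightarrow> real) \<Rightarrow> (nat \<Rightarrow> nat) \<Rightarrow> nat \<Rightarrow> real" where
  "step_size a b n i = (b i - a i) / (real (n i) + 1)"

definition eta :: "(nat \<Rightarrow> real) \<Rightarrow> (nat \<Rightarrow> real) \<Rightarrow> (nat \<Rightarrow> real) \<Rightarrow> (nat \<Rightarrow> nat) \<Rightarrow>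
    real \<Rightarrow> nat \<Rightarrow> nat \<Rightarrow> real" where
  "eta \<delta> a b n T M i =
    (T / real M) / (2 * Gamma (\<delta> i + 1) * step_size a b n i powr (2 - \<delta> i))"

definition coeff_mat :: "(nat \<Rightarrow> real) \<Rightarrow> (nat \<Rightarrow> real) \<Rightarrow> (nat \<Rightarrow> real) \<Rightarrow>
    (nat \<Rightarrow> real) \<Rightarrow> (nat \<Rightarrow> real) \<Rightarrow> (nat \<Rightarrow> nat) \<Rightarrow> real \<Rightarrow> nat \<Rightarrow> real mat" where
  "coeff_mat \<delta> a b kp km n T M =
    (let \<eta> = eta \<delta> a b n T M;
         A = (\<lambda>i. A_mat (n i));
         B = (\<lambda>i. B_mat (kp i) (km i) (\<delta> i) (n i))
     in A 3 \<otimes>\<^sub>K A 2 \<otimes>\<^sub>K A 1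
      + \<eta> 1 \<cdot>\<^sub>m (A 3 \<otimes>\<^sub>K A 2 \<otimes>\<^sub>K B 1)
      + \<eta> 2 \<cdot>\<^sub>m (A 3 \<otimes>\<^sub>K B 2 \<otimes>\<^sub>K A 1)
      + \<eta> 3 \<cdot>\<^sub>m (B 3 \<otimes>\<^sub>K A 2 \<otimes>\<^sub>K A 1))"

definition precond_mat :: "(nat \<Rightarrow> real) \<Rightarrow> (nat \<Rightarrow> real) \<Rightarrow> (nat \<Rightarrow> real) \<Rightarrow>
    (nat \<Rightarrow> real) \<Rightarrow> (nat \<Rightarrow> real) \<Rightarrow> (nat \<Rightarrow> nat) \<Rightarrow> real \<Rightarrow> nat \<Rightarrow> real mat" where
  "precond_mat \<delta> a b kp km n T M =
    (let \<eta> = eta \<delta> a b n T M;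
         A = (\<lambda>i. A_mat (n i));
         R = (\<lambda>i. tau_mat (sym_part (B_mat (kp i) (km i) (\<delta> i) (n i))))
     in A 3 \<otimes>\<^sub>K A 2 \<otimes>\<^sub>K A 1
      + \<eta> 1 \<cdot>\<^sub>m (A 3 \<otimes>\<^sub>K A 2 \<otimes>\<^sub>K R 1)
      + \<eta> 2 \<cdot>\<^sub>m (A 3 \<otimes>\<^sub>K R 2 \<otimes>\<^sub>K A 1)
      + \<eta> 3 \<cdot>\<^sub>m (R 3 \<otimes>\<^sub>K A 2 \<otimes>\<^sub>K A 1))"

definition spd :: "real mat \<Rightarrow> bool" where
  "spd X \<longleftrightarrow> square_mat X \<and> transpose_mat X = X \<and>
    (\<forall>v \<in> carrier_vec (dim_row X). v \<noteq> 0\<^sub>v (dim_row X) \<longrightarrow> scalar_prod v (X *\<^sub>v v) > 0)"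

text \<open>
  For symmetric positive definite X the square root exists and is unique and its
  inverse is not None; for other X the values are unspecified.
\<close>

definition spd_sqrt :: "real mat \<Rightarrow> real mat" where
  "spd_sqrt X = (THE Q. spd Q \<and> Q * Q = X)"

definition inv_sqrt_mat :: "real mat \<Rightarrow> real mat" where
  "inv_sqrt_mat X = the (mat_inverse (spd_sqrt X))"

definition varsigma :: "(nat \<Rightarrow> real) \<Rightarrow> (nat \<Rightarrow> real) \<Rightarrow> (nat \<Rightarrow> real) \<Rightarrow> real" where
  "varsigma \<delta> kp km =
    3/2 * Max ((\<lambda>i. tan (\<delta> i / 2 * pi) * (\<bar>kp i - km i\<bar> / (kp i + km i))) ` {1..3::nat})"

end

theory Submission
  imports Defs "HOL-Analysis.Change_Of_Vars"
begin

text \<open>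
  An eigenvector v of W S W, where W is the inverse square root of P and S the skew part of A,
  with eigenvalue z satisfies z |v|^2 = (W v)^* S (W v) and |v|^2 = (W v)^* P (W v). So it
  suffices to bound the imaginary part of the quadratic form of A by the quadratic form of P, and
  since all matrices A_n are diagonalised by the sine transform with positive eigenvalues, this
  reduces to one dimension: |Im x^* B x| against x^* \<tau>(H(B)) x.

  The entries of T_n are third differences of the truncated power max(w,0)^\<delta> at half-odd integers w.
  Up to terms killed by the differences, that power is an integral over r > 0 of
  r^\<delta> Re (\<i> e^(\<i>\<pi>\<delta>/2) / (r + \<i> w)), and 1 / (r + \<i> w) is a Fourier integral of e^(r(\<pi>-t)) over a
  period. So the generating function of T_n becomes e^(\<i>\<pi>\<delta>/2) p + e^(-\<i>\<pi>\<delta>/2) q with p, q \<ge> 0: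
  the numerical range of T_n lies in the sector |arg| \<le> \<pi>\<delta>/2, which gives the factor tan (\<pi>\<delta>/2).

  The matrix E = H(T_n) - \<tau>(H(T_n)) is a Hankel matrix, and by the signs, the monotonicity and the
  partial sums of the coefficients \<tau>(H(T_n)) / 2 - E is diagonally dominant with nonnegative diagonal.
  This is the factor 3/2.
\<close>

section \<open>Fractional powers as integrals of rational functions\<close>

text \<open>Eigenvectors of a real skew matrix are complex, so all forms are taken on complex
  vectors, and bounding an imaginary part by a real part is a statement about an angle. Such a bound
  survives sums with nonnegative weights and integrals. This is why the coefficients of T_n are
  written as a mixture over r, and why one-dimensional bounds pass through Kronecker products. The
  half-odd nodes matter: e^(-2 \<pi> \<i> w) = -1 for each of them, so the boundary terms of the
  Fourier integral give a factor 2 cosh (\<pi> r) common to all coefficients. The third difference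
  becomes 8 sin (t/2)^3, nonnegative on [0, 2 \<pi>], and its factor \<i> matches the one in the
  kernel; only the rotation by \<pi> \<delta> / 2 remains. The kernel is a real part, so a term with
  the opposite rotation appears as well: it comes from the same form at the conjugate vector, hence
  the pair p, q. The sector bounds Im by H(T_n), whereas P contains \<tau>(H(T_n)). Comparing these
  two is where the signs of finite differences up to order four enter. The summand common to A and P
  has a real form and needs only a nonnegative one.\<close>

lemma Beta_reflection_real:
  fixes a :: real
  assumes "0 < a" "a < 1"
  shows "Beta a (1 - a) = pi / sin (pi * a)"
proof -
  have "Gamma (complex_of_real a) * Gamma (complex_of_real (1 - a)) =
      of_real pi / sin (complex_of_real (pi * a))"
    using Gamma_reflection_complex[of "complex_of_real a"] by (simp only: of_real_diff of_real_1 of_real_mult)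
  then have "complex_of_real (Gamma a * Gamma (1 - a)) = complex_of_real (pi / sin (pi * a))"
    by (simp only: Gamma_complex_of_real of_real_mult[symmetric] sin_of_real of_real_divide)
  then show ?thesis
    unfolding of_real_eq_iff by (simp add: Beta_def)
qed

text \<open>The substitution t = r^2 / (r^2 + w^2) turns the Beta integral with parameters a/2 and 1
  - a/2 into this one. The range of a covers both exponents needed below, a = \<delta> and a =
  \<delta> + 1.\<close>

lemma powr_rational_integral:
  fixes a w :: real
  assumes a: "0 < a" "a < 2" and w: "0 < w"
  shows "((\<lambda>r. r powr (a - 1) / (r\<^sup>2 + w\<^sup>2)) has_integral
           w powr (a - 2) * pi / (2 * sin (pi * a / 2))) {0<..}"
proof -
  define f where "f t = t powr (a/2 - 1) * (1 - t) powr ((1 - a/2) - 1)" for t :: real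
  define g where "g r = r\<^sup>2 / (r\<^sup>2 + w\<^sup>2)" for r :: real
  define g' where "g' r = 2 * r * w\<^sup>2 / (r\<^sup>2 + w\<^sup>2)\<^sup>2" for r :: real
  have pos: "r\<^sup>2 + w\<^sup>2 > 0" for r
    using w by (simp add: add_nonneg_pos)
  have der: "(g has_field_derivative g' r) (at r within {0<..})" for r
    unfolding g_def g'_def using pos[of r]
    by (auto intro!: derivative_eq_intros simp: field_simps power2_eq_square)
  have inj: "inj_on g {0<..}"
  proof (rule inj_onI)
    fix x y assume xy: "x \<in> {0<..}" "y \<in> {0<..}" "g x = g y"
    then have "x\<^sup>2 * (y\<^sup>2 + w\<^sup>2) = y\<^sup>2 * (x\<^sup>2 + w\<^sup>2)"
      using pos[of x] pos[of y] by (simp add: g_def frac_eq_eq)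
    then have "x\<^sup>2 = y\<^sup>2" using w by (simp add: algebra_simps)
    then show "x = y" using xy by (simp add: power2_eq_iff)
  qed
  have img: "g ` {0<..} = {0<..<1}"
  proof (intro equalityI subsetI)
    fix y assume "y \<in> g ` {0<..}"
    then obtain r where "r > 0" "y = g r" by auto
    then show "y \<in> {0<..<1}" using w pos[of r] by (simp add: g_def)
  next
    fix y :: real assume y: "y \<in> {0<..<1}"
    define r where "r = w * sqrt (y / (1 - y))"
    have "r > 0" using w y by (simp add: r_def)
    moreover have "r\<^sup>2 = w\<^sup>2 * (y / (1 - y))" using y by (simp add: r_def power_mult_distrib)
    then have "r\<^sup>2 + w\<^sup>2 = w\<^sup>2 / (1 - y)" "r\<^sup>2 = w\<^sup>2 * y / (1 - y)" using y by (simp_all add: field_simps)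
    then have "g r = y" using w y by (simp add: g_def)
    ultimately show "y \<in> g ` {0<..}" by auto
  qed
  have "(f has_integral Beta (a/2) (1 - a/2)) {0..1}"
    unfolding f_def using a by (intro has_integral_Beta_real) auto
  then have "(f has_integral pi / sin (pi * (a/2))) (g ` {0<..})"
    using a by (simp add: img has_integral_Icc_iff_Ioo Beta_reflection_real)
  moreover have "f absolutely_integrable_on g ` {0<..}"
    using calculation
    by (intro nonnegative_absolutely_integrable_1) (auto simp: f_def has_integral_integrable_integral)
  ultimately have "(\<lambda>r. \<bar>g' r\<bar> * f (g r)) absolutely_integrable_on {0<..} \<and>
      integral {0<..} (\<lambda>r. \<bar>g' r\<bar> * f (g r)) = pi / sin (pi * (a/2))"
    by (subst has_absolute_integral_change_of_variables_1'[OF _ der inj]) (auto intro: integral_unique)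
  then have "((\<lambda>r. \<bar>g' r\<bar> * f (g r)) has_integral pi / sin (pi * (a/2))) {0<..}"
    using has_integral_integrable_integral set_lebesgue_integral_eq_integral(1) by blast
  then have "((\<lambda>r. w powr (a - 2) / 2 * (\<bar>g' r\<bar> * f (g r))) has_integral
      w powr (a - 2) / 2 * (pi / sin (pi * (a/2)))) {0<..}"
    by (rule has_integral_mult_right)
  moreover have "w powr (a - 2) / 2 * (\<bar>g' r\<bar> * f (g r)) = r powr (a - 1) / (r\<^sup>2 + w\<^sup>2)" if "r \<in> {0<..}" for r
  proof -
    have r: "r > 0" using that by simp
    \<comment> \<open>Writing r, w and r^2 + w^2 as exponentials reduces the identity of powers to a
      linear identity of exponents.\<close>
    define L where "L = ln (r\<^sup>2 + w\<^sup>2)"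
    have "g r + w\<^sup>2 / (r\<^sup>2 + w\<^sup>2) = (r\<^sup>2 + w\<^sup>2) / (r\<^sup>2 + w\<^sup>2)"
      unfolding g_def by (rule add_divide_distrib[symmetric])
    then have 1: "1 - g r = w\<^sup>2 / (r\<^sup>2 + w\<^sup>2)" using w by simp
    have q: "r\<^sup>2 + w\<^sup>2 = exp L" "r = exp (ln r)" "w = exp (ln w)" using pos[of r] r w by (auto simp: L_def)
    have gr: "g r = exp (2 * ln r - L)"
      unfolding g_def q(1) exp_diff using r by (simp add: exp_double)
    have gr1: "1 - g r = exp (2 * ln w - L)"
      unfolding 1 q(1) exp_diff using w by (simp add: exp_double)
    have g'r: "\<bar>g' r\<bar> = 2 * exp (ln r + 2 * ln w - 2 * L)"
      unfolding g'_def q(1) exp_diff exp_add using r w by (simp add: exp_double abs_mult)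
    have p1: "w powr (a - 2) = exp ((a - 2) * ln w)" and p2: "r powr (a - 1) = exp ((a - 1) * ln r)"
      using r w by (auto simp: powr_def)
    show ?thesis
      unfolding f_def gr1 unfolding gr g'r p1 p2 q(1)
      by (simp add: powr_def algebra_simps flip: exp_add exp_diff)
  qed
  ultimately have "((\<lambda>r. r powr (a - 1) / (r\<^sup>2 + w\<^sup>2)) has_integral
      w powr (a - 2) / 2 * (pi / sin (pi * (a/2)))) {0<..}"
    by (rule has_integral_eq[rotated])
  then show ?thesis by simp
qed

section \<open>Toeplitz coefficients as third differences of a truncated power\<close>

definition pos_powr :: "real \<Rightarrow> real \<Rightarrow> real" where
  "pos_powr d w = (if 0 < w then w powr d else 0)"

text \<open>The index m is row minus column; hence the shift by one, with m = -1 as the single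
  superdiagonal of the Hessenberg shape.\<close>

definition toep_coeff :: "real \<Rightarrow> int \<Rightarrow> real" where
  "toep_coeff d m = (if - 1 \<le> m then q_coeff d (nat (m + 1)) else 0)"

text \<open>The irregular values of \<open>s_coeff\<close> at 0 and 1 are what the generic second
  difference gives once the power is cut off at negative arguments. So one formula covers all
  diagonals, the vanishing ones included.\<close>

lemma toep_coeff_conv_pos_powr:
  "toep_coeff d m = pos_powr d (of_int m - 3/2) - 3 * pos_powr d (of_int m - 1/2)
     + 3 * pos_powr d (of_int m + 1/2) - pos_powr d (of_int m + 3/2)"
proof -
  consider "m < -1" | "m = -1" | "m = 0" | "m = 1" | "m \<ge> 2" by linarith
  then show ?thesis
  proof cases
    case 1
    then have "m \<le> -2" by simp
    then have "real_of_int m \<le> -2" by linarith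
    with 1 show ?thesis by (simp add: toep_coeff_def pos_powr_def)
  next
    case 5
    define k where "k = nat m"
    have k: "k \<ge> 2" "m = int k" using 5 by (auto simp: k_def)
    have "nat (m + 1) = Suc k" using k by simp
    moreover have "real k \<ge> 2" using k by simp
    ultimately show ?thesis using k
      by (simp add: toep_coeff_def pos_powr_def q_coeff_def s_coeff_def algebra_simps)
  qed (simp_all add: toep_coeff_def pos_powr_def q_coeff_def s_coeff_def)
qed

text \<open>Up to a term independent of w this is r^\<delta> Re (\<i> e^(\<i>\<pi>\<delta>/2) / (r + \<i> w)); subtracting that
  term makes the kernel integrable, and it drops out of the third difference below.\<close>

definition powr_kernel :: "real \<Rightarrow> real \<Rightarrow> real \<Rightarrow> real" where
  "powr_kernel d w r = sin (pi * d / 2) * (r powr (d - 1) * w\<^sup>2 / (r\<^sup>2 + w\<^sup>2))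
     + cos (pi * d / 2) * (r powr d * w / (r\<^sup>2 + w\<^sup>2))"

text \<open>Both summands of the kernel integrate to \<pi>/2 |w|^\<delta>, the second one with the
  sign of w. They add up for w > 0 and cancel for w < 0, which produces the truncation.\<close>

lemma powr_kernel_integral:
  assumes d: "0 < d" "d < 1" and w: "w \<noteq> 0"
  shows "(powr_kernel d w has_integral pi * pos_powr d w) {0<..}"
proof -
  have sp: "sin (pi * d / 2) > 0" using d by (intro sin_gt_zero) (auto simp: field_simps)
  have cp: "cos (pi * d / 2) > 0" using d by (intro cos_gt_zero_pi) (auto simp: field_simps intro: order_less_le_trans[of _ 0])
  have aw: "\<bar>w\<bar> > 0" using w by simp
  have I1: "((\<lambda>r. r powr (d - 1) / (r\<^sup>2 + w\<^sup>2)) has_integral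
      \<bar>w\<bar> powr (d - 2) * pi / (2 * sin (pi * d / 2))) {0<..}"
    using powr_rational_integral[of d "\<bar>w\<bar>"] d aw by simp
  have s2: "sin (pi * (d + 1) / 2) = cos (pi * d / 2)"
    by (simp add: distrib_left add_divide_distrib sin_add)
  have I2: "((\<lambda>r. r powr d / (r\<^sup>2 + w\<^sup>2)) has_integral
      \<bar>w\<bar> powr (d - 1) * pi / (2 * cos (pi * d / 2))) {0<..}"
    using powr_rational_integral[of "d + 1" "\<bar>w\<bar>"] d aw s2 by simp
  have "((\<lambda>r. sin (pi * d / 2) * w\<^sup>2 * (r powr (d - 1) / (r\<^sup>2 + w\<^sup>2))
      + cos (pi * d / 2) * w * (r powr d / (r\<^sup>2 + w\<^sup>2))) has_integral
      sin (pi * d / 2) * w\<^sup>2 * (\<bar>w\<bar> powr (d - 2) * pi / (2 * sin (pi * d / 2)))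
      + cos (pi * d / 2) * w * (\<bar>w\<bar> powr (d - 1) * pi / (2 * cos (pi * d / 2)))) {0<..}"
    by (intro has_integral_add has_integral_mult_right I1 I2)
  moreover have "(\<lambda>r. sin (pi * d / 2) * w\<^sup>2 * (r powr (d - 1) / (r\<^sup>2 + w\<^sup>2))
      + cos (pi * d / 2) * w * (r powr d / (r\<^sup>2 + w\<^sup>2))) = powr_kernel d w"
    by (intro ext) (simp add: powr_kernel_def mult_ac)
  moreover have "w\<^sup>2 * \<bar>w\<bar> powr (d - 2) = \<bar>w\<bar> powr d"
    using powr_add[of "\<bar>w\<bar>" 2 "d - 2"] aw by (simp add: powr_numeral)
  moreover have "\<bar>w\<bar> * \<bar>w\<bar> powr (d - 1) = \<bar>w\<bar> powr d"
    using powr_add[of "\<bar>w\<bar>" 1 "d - 1"] aw by simp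
  then have "w * \<bar>w\<bar> powr (d - 1) = sgn w * \<bar>w\<bar> powr d"
    by (metis mult.assoc sgn_mult_abs)
  ultimately have "(powr_kernel d w has_integral pi / 2 * (\<bar>w\<bar> powr d + sgn w * \<bar>w\<bar> powr d)) {0<..}"
    using sp cp by (simp add: field_simps)
  moreover have "pi / 2 * (\<bar>w\<bar> powr d + sgn w * \<bar>w\<bar> powr d) = pi * pos_powr d w"
    using w by (auto simp: pos_powr_def sgn_if)
  ultimately show ?thesis by simp
qed

definition toep_kernel :: "real \<Rightarrow> int \<Rightarrow> real \<Rightarrow> real" where
  "toep_kernel d m r = powr_kernel d (of_int m - 3/2) r - 3 * powr_kernel d (of_int m - 1/2) r
     + 3 * powr_kernel d (of_int m + 1/2) r - powr_kernel d (of_int m + 3/2) r"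

lemma half_odd_neq_zero:
  fixes m :: int
  shows "real_of_int m - 3/2 \<noteq> 0" "real_of_int m - 1/2 \<noteq> 0"
    "real_of_int m + 1/2 \<noteq> 0" "real_of_int m + 3/2 \<noteq> 0"
proof -
  have "2 * m \<noteq> 3" "2 * m \<noteq> 1" "2 * m \<noteq> -1" "2 * m \<noteq> -3" by presburger+
  then have "2 * real_of_int m \<noteq> 3" "2 * real_of_int m \<noteq> 1" "2 * real_of_int m \<noteq> -1" "2 * real_of_int m \<noteq> -3"
    by linarith+
  then show "real_of_int m - 3/2 \<noteq> 0" "real_of_int m - 1/2 \<noteq> 0"
    "real_of_int m + 1/2 \<noteq> 0" "real_of_int m + 3/2 \<noteq> 0" by auto
qed

lemma toep_kernel_integral:
  assumes d: "0 < d" "d < 1"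
  shows "(toep_kernel d m has_integral pi * toep_coeff d m) {0<..}"
proof -
  have "((\<lambda>r. powr_kernel d (of_int m - 3/2) r - 3 * powr_kernel d (of_int m - 1/2) r
     + 3 * powr_kernel d (of_int m + 1/2) r - powr_kernel d (of_int m + 3/2) r) has_integral
     pi * pos_powr d (of_int m - 3/2) - 3 * (pi * pos_powr d (of_int m - 1/2))
     + 3 * (pi * pos_powr d (of_int m + 1/2)) - pi * pos_powr d (of_int m + 3/2)) {0<..}"
    by (intro has_integral_add has_integral_diff has_integral_mult_right powr_kernel_integral d half_odd_neq_zero)
  then show ?thesis
    unfolding toep_coeff_conv_pos_powr toep_kernel_def[abs_def] by (simp add: algebra_simps)
qed

lemma powr_kernel_complex:
  assumes "0 < r"
  shows "powr_kernel d w r = r powr d * (sin (pi * d / 2) / r)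
    + r powr d * Re (\<i> * cis (pi * d / 2) / (of_real r + \<i> * of_real w))"
proof -
  have pos: "r * r + w * w > 0" using assms by (simp add: add_pos_nonneg)
  have p: "r powr d = r * r powr (d - 1)" using assms powr_add[of r 1 "d - 1"] by simp
  define D where "D = r * r + w * w"
  have D: "D > 0" using pos by (simp add: D_def)
  have 1: "Re (\<i> * cis (pi * d / 2) / (of_real r + \<i> * of_real w)) =
     (cos (pi * d / 2) * w - sin (pi * d / 2) * r) / D"
    by (simp add: Re_divide power2_eq_square D_def)
  have 2: "powr_kernel d w r = r powr (d - 1) * (sin (pi * d / 2) * (w * w / D)
      + cos (pi * d / 2) * (r * w / D))"
    unfolding powr_kernel_def p D_def by (simp add: power2_eq_square algebra_simps)
  have "w * w = D - r * r" by (simp add: D_def)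
  then have 3: "w * w / D = 1 - r * r / D"
    using D by (simp add: diff_divide_distrib)
  show ?thesis
    unfolding 2 1 3 p using assms by (simp add: diff_divide_distrib algebra_simps)
qed

text \<open>Because w is half-odd, the exponential changes sign over the period. The two boundary
  terms therefore add up to 2 cosh (\<pi> r), which does not depend on m and factors out of all
  linear combinations.\<close>

lemma exp_half_odd_integral:
  fixes m :: int and r :: real
  assumes "0 < r"
  defines "w \<equiv> real_of_int m + 1/2"
  shows "((\<lambda>t. exp (of_real (r * (pi - t)) - \<i> * of_real (w * t))) has_integral
           of_real (2 * cosh (pi * r)) / (of_real r + \<i> * of_real w)) {0..2*pi}"
proof -
  define z where "z = complex_of_real r + \<i> * of_real w"
  have z: "z \<noteq> 0" using assms by (auto simp: z_def complex_eq_iff)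
  define F where "F t = - exp (of_real (r * pi) - z * of_real t) / z" for t
  have "(F has_vector_derivative exp (of_real (r * (pi - t)) - \<i> * of_real (w * t))) (at t within {0..2*pi})" for t
  proof -
    have "((\<lambda>u. - exp (of_real (r * pi) - z * u) / z) has_field_derivative
        exp (of_real (r * pi) - z * of_real t)) (at (of_real t))"
      using z by (auto intro!: derivative_eq_intros)
    then have "(F has_vector_derivative exp (of_real (r * pi) - z * of_real t)) (at t within {0..2*pi})"
      unfolding F_def by (rule has_vector_derivative_real_field)
    then show ?thesis by (simp add: z_def algebra_simps)
  qed
  then have "((\<lambda>t. exp (of_real (r * (pi - t)) - \<i> * of_real (w * t))) has_integral F (2*pi) - F 0) {0..2*pi}"
    by (intro fundamental_theorem_of_calculus) auto
  moreover have "exp (complex_of_real (r * pi) - z * of_real (2*pi)) =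
      exp (- of_real (r * pi)) * exp (- (2 * of_int m * of_real pi * \<i>)) * exp (- (of_real pi * \<i>))"
    unfolding z_def w_def by (simp add: exp_add[symmetric] algebra_simps)
  then have "exp (complex_of_real (r * pi) - z * of_real (2*pi)) = - exp (- of_real (r * pi))"
    using exp_integer_2pi[of "of_int m"] by (simp add: exp_minus)
  then have "F (2*pi) - F 0 = of_real (2 * cosh (pi * r)) / z"
    by (simp add: F_def cosh_def add_divide_distrib exp_of_real[symmetric] mult.commute del: exp_of_real)
  ultimately show ?thesis by (simp add: z_def)
qed

section \<open>The numerical range of the Toeplitz matrix\<close>

text \<open>Up to the factor \<open>2 * cosh (pi * r)\<close>, this is the Fourier integral of
  \<open>toep_weight r\<close> at frequency m: a coefficient sequence, not a generating
  function.\<close>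

definition toep_symbol :: "real \<Rightarrow> int \<Rightarrow> complex" where
  "toep_symbol r m = \<i> * (1 / (of_real r + \<i> * of_real (of_int m - 3/2))
     - 3 / (of_real r + \<i> * of_real (of_int m - 1/2))
     + 3 / (of_real r + \<i> * of_real (of_int m + 1/2))
     - 1 / (of_real r + \<i> * of_real (of_int m + 3/2)))"

lemma toep_kernel_conv_symbol:
  assumes "0 < r"
  shows "toep_kernel d m r = r powr d * Re (cis (pi * d / 2) * toep_symbol r m)"
proof -
  have "cis (pi * d / 2) * toep_symbol r m =
     \<i> * cis (pi * d / 2) / (of_real r + \<i> * of_real (of_int m - 3/2))
     - of_real 3 * (\<i> * cis (pi * d / 2) / (of_real r + \<i> * of_real (of_int m - 1/2)))
     + of_real 3 * (\<i> * cis (pi * d / 2) / (of_real r + \<i> * of_real (of_int m + 1/2)))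
     - \<i> * cis (pi * d / 2) / (of_real r + \<i> * of_real (of_int m + 3/2))"
    unfolding toep_symbol_def by (simp add: field_simps)
  then have "Re (cis (pi * d / 2) * toep_symbol r m) =
     Re (\<i> * cis (pi * d / 2) / (of_real r + \<i> * of_real (of_int m - 3/2)))
     - 3 * Re (\<i> * cis (pi * d / 2) / (of_real r + \<i> * of_real (of_int m - 1/2)))
     + 3 * Re (\<i> * cis (pi * d / 2) / (of_real r + \<i> * of_real (of_int m + 1/2)))
     - Re (\<i> * cis (pi * d / 2) / (of_real r + \<i> * of_real (of_int m + 3/2)))"
    by (simp only: minus_complex.sel plus_complex.sel times_complex.sel Re_complex_of_real
        Im_complex_of_real mult_zero_left diff_0_right)
  then show ?thesis
    unfolding toep_kernel_def powr_kernel_complex[OF assms] by (simp only:) (simp add: algebra_simps)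
qed

text \<open>The sine factor is, up to a power of \<i>, the Fourier multiplier of the centred third
  difference. The period is taken from 0 to 2 \<pi> because sin (t/2) keeps its sign there.\<close>

definition toep_weight :: "real \<Rightarrow> real \<Rightarrow> real" where
  "toep_weight r t = 8 * sin (t / 2) ^ 3 * exp (r * (pi - t))"

lemma toep_weight_expand:
  "of_real (toep_weight r t) * exp (- (\<i> * of_real (of_int m * t))) =
    \<i> * (exp (of_real (r * (pi - t)) - \<i> * of_real ((of_int (m - 2) + 1/2) * t))
     - 3 * exp (of_real (r * (pi - t)) - \<i> * of_real ((of_int (m - 1) + 1/2) * t))
     + 3 * exp (of_real (r * (pi - t)) - \<i> * of_real ((of_int m + 1/2) * t))
     - exp (of_real (r * (pi - t)) - \<i> * of_real ((of_int (m + 1) + 1/2) * t)))"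
proof -
  define h where "h = exp (\<i> * complex_of_real (t / 2))"
  define E where "E = exp (complex_of_real (r * (pi - t))) * exp (- (\<i> * of_real (of_int m * t)))"
  have h0: "h \<noteq> 0" by (simp add: h_def)
  have hi: "exp (- (\<i> * complex_of_real (t / 2))) = 1 / h"
    by (simp add: h_def exp_minus inverse_eq_divide)
  have s: "complex_of_real (sin (t / 2)) = (h - 1 / h) / (2 * \<i>)"
    unfolding sin_of_real[symmetric] sin_exp_eq' h_def[symmetric] hi
    by (simp add: sin_exp_eq h_def exp_minus inverse_eq_divide divide_simps) (simp add: algebra_simps)
  \<comment> \<open>The shifts k = -2, -1, 0, 1 give h^3, h, 1/h, 1/h^3, the powers in (h -
    1/h)^3.\<close>
  have e: "exp (of_real (r * (pi - t)) - \<i> * of_real ((of_int (m + k) + 1/2) * t)) =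
      E * exp (of_int (- 2 * k - 1) * (\<i> * complex_of_real (t / 2)))" for k :: int
    unfolding E_def exp_add[symmetric] by (rule arg_cong[of _ _ exp]) (simp add: field_simps)
  have e1: "exp (of_int 3 * (\<i> * complex_of_real (t / 2))) = h ^ 3"
    "exp (of_int 1 * (\<i> * complex_of_real (t / 2))) = h"
    "exp (of_int (-1) * (\<i> * complex_of_real (t / 2))) = 1 / h"
    "exp (of_int (-3) * (\<i> * complex_of_real (t / 2))) = 1 / h ^ 3"
    unfolding h_def exp_of_nat_mult[symmetric]
    by (simp_all add: exp_minus inverse_eq_divide flip: exp_of_nat_mult)
  have "of_real (toep_weight r t) * exp (- (\<i> * of_real (of_int m * t))) =
     8 * ((h - 1 / h) / (2 * \<i>)) ^ 3 * E"
    unfolding toep_weight_def E_def of_real_mult of_real_power s by (simp flip: exp_of_real)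
  also have "\<dots> = \<i> * (E * h ^ 3 - 3 * (E * h) + 3 * (E * (1 / h)) - E * (1 / h ^ 3))"
    using h0 by (simp add: field_simps power3_eq_cube)
  finally show ?thesis
    using e[of "-2"] e[of "-1"] e[of 0] e[of 1] e1 by simp
qed

lemma toep_weight_fourier:
  assumes "0 < r"
  shows "((\<lambda>t. of_real (toep_weight r t) * exp (- (\<i> * of_real (of_int m * t)))) has_integral
           of_real (2 * cosh (pi * r)) * toep_symbol r m) {0..2*pi}"
proof -
  let ?e = "\<lambda>k t. exp (of_real (r * (pi - t)) - \<i> * of_real ((of_int k + 1/2) * t))"
  let ?I = "\<lambda>k. complex_of_real (2 * cosh (pi * r)) / (of_real r + \<i> * of_real (of_int k + 1/2))"
  have I: "(?e k has_integral ?I k) {0..2*pi}" for k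
    using exp_half_odd_integral[OF assms, of k] .
  have "((\<lambda>t. \<i> * (?e (m - 2) t - 3 * ?e (m - 1) t + 3 * ?e m t - ?e (m + 1) t)) has_integral
      \<i> * (?I (m - 2) - 3 * ?I (m - 1) + 3 * ?I m - ?I (m + 1))) {0..2*pi}"
    by (intro has_integral_mult_right has_integral_add has_integral_diff I)
  moreover have "\<i> * (?I (m - 2) - 3 * ?I (m - 1) + 3 * ?I m - ?I (m + 1)) =
      of_real (2 * cosh (pi * r)) * toep_symbol r m"
    by (simp add: toep_symbol_def algebra_simps add_divide_distrib diff_divide_distrib)
  ultimately show ?thesis
    unfolding toep_weight_expand by simp
qed

definition toep_form :: "(int \<Rightarrow> complex) \<Rightarrow> nat \<Rightarrow> (nat \<Rightarrow> complex) \<Rightarrow> complex" where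
  "toep_form c n x = (\<Sum>j<n. \<Sum>k<n. cnj (x j) * x k * c (int j - int k))"

text \<open>Fourier coefficients of a nonnegative function form a positive semidefinite Toeplitz
  matrix: up to a positive factor the form is the integral of the weight times |X(t)|^2, where X is
  the trigonometric polynomial with coefficients x.\<close>

lemma toep_symbol_form_nonneg:
  assumes "0 < r"
  shows "\<exists>p\<ge>0. toep_form (toep_symbol r) n x = of_real p"
proof -
  define X where "X t = (\<Sum>k<n. x k * exp (\<i> * of_real (real k * t)))" for t
  define C where "C = 2 * cosh (pi * r)"
  have C: "C > 0" by (simp add: C_def)
  have "((\<lambda>t. \<Sum>j<n. \<Sum>k<n. cnj (x j) * x k *
        (of_real (toep_weight r t) * exp (- (\<i> * of_real (of_int (int j - int k) * t))))) has_integral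
     (\<Sum>j<n. \<Sum>k<n. cnj (x j) * x k * (of_real C * toep_symbol r (int j - int k)))) {0..2*pi}"
    unfolding C_def by (intro has_integral_sum has_integral_mult_right toep_weight_fourier assms) auto
  moreover have "(\<Sum>j<n. \<Sum>k<n. cnj (x j) * x k *
        (of_real (toep_weight r t) * exp (- (\<i> * of_real (of_int (int j - int k) * t))))) =
     of_real (toep_weight r t * (cmod (X t))\<^sup>2)" for t
  proof -
    have "exp (- (\<i> * of_real (of_int (int j - int k) * t))) =
        cnj (exp (\<i> * of_real (real j * t))) * exp (\<i> * of_real (real k * t))" for j k
      by (simp add: exp_cnj flip: exp_add) (simp add: algebra_simps)
    then have e: "cnj (x j) * x k * (of_real (toep_weight r t) * exp (- (\<i> * of_real (of_int (int j - int k) * t)))) =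
        of_real (toep_weight r t) * (cnj (x j * exp (\<i> * of_real (real j * t))) * (x k * exp (\<i> * of_real (real k * t))))" for j k
      by (simp only: complex_cnj_mult mult_ac)
    have "(\<Sum>j<n. \<Sum>k<n. cnj (x j) * x k *
        (of_real (toep_weight r t) * exp (- (\<i> * of_real (of_int (int j - int k) * t))))) =
      of_real (toep_weight r t) * (cnj (X t) * X t)"
      unfolding e X_def cnj_sum sum_product by (simp only: sum_distrib_left)
    also have "cnj (X t) * X t = of_real ((cmod (X t))\<^sup>2)"
      by (simp only: complex_norm_square mult.commute)
    finally show ?thesis by simp
  qed
  moreover have "(\<Sum>j<n. \<Sum>k<n. cnj (x j) * x k * (of_real C * toep_symbol r (int j - int k))) =
     of_real C * toep_form (toep_symbol r) n x"
    unfolding toep_form_def sum_distrib_left by (intro sum.cong refl) (simp add: mult_ac)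
  ultimately have I: "((\<lambda>t. complex_of_real (toep_weight r t * (cmod (X t))\<^sup>2)) has_integral
      of_real C * toep_form (toep_symbol r) n x) {0..2*pi}" by simp
  have R: "((\<lambda>t. toep_weight r t * (cmod (X t))\<^sup>2) has_integral C * Re (toep_form (toep_symbol r) n x)) {0..2*pi}"
    using has_integral_Re[OF I] by simp
  have "((\<lambda>t. 0) has_integral C * Im (toep_form (toep_symbol r) n x)) {0..2*pi}"
    using has_integral_Im[OF I] by simp
  then have "Im (toep_form (toep_symbol r) n x) = 0"
    using C by (simp add: has_integral_0_eq)
  moreover have "toep_weight r t \<ge> 0" if "t \<in> {0..2*pi}" for t
    using that sin_ge_zero[of "t/2"] by (simp add: toep_weight_def)
  then have "C * Re (toep_form (toep_symbol r) n x) \<ge> 0"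
    by (intro has_integral_nonneg[OF R]) auto
  then have "Re (toep_form (toep_symbol r) n x) \<ge> 0" using C by (simp add: zero_le_mult_iff)
  ultimately show ?thesis by (intro exI[of _ "Re (toep_form (toep_symbol r) n x)"]) (simp add: complex_eq_iff)
qed

text \<open>Since the kernel is a real part, its form is a positive multiple of u p + cnj u q with u
  = e^(\<i> \<pi> \<delta> / 2). Here q is the form of the same coefficients at the conjugate
  vector, so it is nonnegative for the same reason as p, and Q lies in the cone spanned by u and its
  conjugate.\<close>

lemma toep_kernel_form_sector:
  fixes x :: "nat \<Rightarrow> complex" and n :: nat
  assumes d: "0 < d" "d < 1" and r: "0 < r"
  defines "Q \<equiv> toep_form (\<lambda>m. of_real (toep_kernel d m r)) n x"
  shows "\<bar>Im Q\<bar> \<le> tan (pi * d / 2) * Re Q"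
proof -
  let ?F = "toep_form (toep_symbol r) n"
  obtain p where p: "p \<ge> 0" "?F x = of_real p"
    using toep_symbol_form_nonneg[OF r] by blast
  obtain q where q: "q \<ge> 0" "?F (\<lambda>k. cnj (x k)) = of_real q"
    using toep_symbol_form_nonneg[OF r] by blast
  define u where "u = cis (pi * d / 2)"
  have c: "cos (pi * d / 2) > 0" using d by (intro cos_gt_zero_pi) (auto simp: field_simps intro: order_less_le_trans[of _ 0])
  have s: "sin (pi * d / 2) \<ge> 0" using d by (intro sin_ge_zero) (auto simp: field_simps)
  have re: "complex_of_real (toep_kernel d m r) =
      of_real (r powr d / 2) * (u * toep_symbol r m + cnj u * cnj (toep_symbol r m))" for m
    unfolding toep_kernel_conv_symbol[OF r] u_def[symmetric] complex_eq_iff by simp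
  have "Q = of_real (r powr d / 2) * (u * ?F x + cnj u * cnj (?F (\<lambda>k. cnj (x k))))"
    unfolding Q_def toep_form_def re cnj_sum sum_distrib_left sum.distrib[symmetric]
    by (intro sum.cong refl) (simp add: algebra_simps)
  then have Q: "Q = of_real (r powr d / 2) * (u * of_real p + cnj u * of_real q)"
    by (simp add: p q)
  have 1: "Re Q = r powr d / 2 * cos (pi * d / 2) * (p + q)"
    unfolding Q u_def by (simp add: algebra_simps)
  have 2: "Im Q = r powr d / 2 * sin (pi * d / 2) * (p - q)"
    unfolding Q u_def by (simp add: algebra_simps)
  have "\<bar>Im Q\<bar> = r powr d / 2 * sin (pi * d / 2) * \<bar>p - q\<bar>"
    using s unfolding 2 by (simp add: abs_mult)
  also have "\<dots> \<le> r powr d / 2 * sin (pi * d / 2) * (p + q)"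
    using s p q by (intro mult_left_mono) auto
  also have "\<dots> = tan (pi * d / 2) * Re Q"
    using c unfolding 1 by (simp add: tan_def)
  finally show ?thesis .
qed

text \<open>The opening of the sector does not depend on r, and a sector of this kind is a convex
  cone, so it survives integration over r.\<close>

theorem toep_coeff_form_sector:
  fixes x :: "nat \<Rightarrow> complex" and n :: nat
  assumes d: "0 < d" "d < 1"
  defines "Q \<equiv> toep_form (\<lambda>m. of_real (toep_coeff d m)) n x"
  shows "\<bar>Im Q\<bar> \<le> tan (pi * d / 2) * Re Q"
proof -
  let ?K = "\<lambda>r. toep_form (\<lambda>m. of_real (toep_kernel d m r)) n x"
  have re_mult_real: "Re (z * of_real c) = Re z * c" and im_mult_real: "Im (z * of_real c) = Im z * c" for z c
    by simp_all
  have R: "((\<lambda>r. Re (?K r)) has_integral pi * Re Q) {0<..}"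
  proof -
    have "((\<lambda>r. \<Sum>j<n. \<Sum>k<n. Re (cnj (x j) * x k) * toep_kernel d (int j - int k) r) has_integral
        (\<Sum>j<n. \<Sum>k<n. Re (cnj (x j) * x k) * (pi * toep_coeff d (int j - int k)))) {0<..}"
      by (intro has_integral_sum has_integral_mult_right toep_kernel_integral d) auto
    then show ?thesis
      unfolding Q_def toep_form_def Re_sum sum_distrib_left re_mult_real
      by (simp only: mult_ac)
  qed
  have I: "((\<lambda>r. Im (?K r)) has_integral pi * Im Q) {0<..}"
  proof -
    have "((\<lambda>r. \<Sum>j<n. \<Sum>k<n. Im (cnj (x j) * x k) * toep_kernel d (int j - int k) r) has_integral
        (\<Sum>j<n. \<Sum>k<n. Im (cnj (x j) * x k) * (pi * toep_coeff d (int j - int k)))) {0<..}"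
      by (intro has_integral_sum has_integral_mult_right toep_kernel_integral d) auto
    then show ?thesis
      unfolding Q_def toep_form_def Im_sum sum_distrib_left im_mult_real
      by (simp only: mult_ac)
  qed
  have T: "((\<lambda>r. tan (pi * d / 2) * Re (?K r)) has_integral tan (pi * d / 2) * (pi * Re Q)) {0<..}"
    by (intro has_integral_mult_right R)
  have "pi * Im Q \<le> tan (pi * d / 2) * (pi * Re Q)"
    by (rule has_integral_le[OF I T]) (use toep_kernel_form_sector[OF d] in \<open>auto dest: abs_le_D1\<close>)
  moreover have "- (pi * Im Q) \<le> tan (pi * d / 2) * (pi * Re Q)"
    by (rule has_integral_le[OF has_integral_neg[OF I] T])
      (use toep_kernel_form_sector[OF d] in \<open>auto dest: abs_le_D2\<close>)
  ultimately have "pi * Im Q \<le> pi * (tan (pi * d / 2) * Re Q)" "pi * (- Im Q) \<le> pi * (tan (pi * d / 2) * Re Q)"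
    by (simp_all only: mult.left_commute mult_minus_right)
  then show ?thesis unfolding mult_le_cancel_left_pos[OF pi_gt_zero] by simp
qed

section \<open>Signs of finite differences and the symmetrised coefficients\<close>

fun powr_diff :: "nat \<Rightarrow> real \<Rightarrow> real \<Rightarrow> real" where
  "powr_diff 0 e x = x powr e"
| "powr_diff (Suc k) e x = powr_diff k e (x + 1) - powr_diff k e x"

lemma powr_diff_has_real_derivative:
  "0 < x \<Longrightarrow> (powr_diff k e has_real_derivative e * powr_diff k (e - 1) x) (at x)"
proof (induction k arbitrary: x)
  case 0
  then show ?case by (auto intro!: derivative_eq_intros)
next
  case (Suc k)
  have "((\<lambda>x. powr_diff k e (x + 1)) has_real_derivative e * powr_diff k (e - 1) (x + 1)) (at x)"
    using Suc.IH[of "x + 1"] Suc.prems by (simp add: DERIV_shift)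
  then have "((\<lambda>x. powr_diff k e (x + 1) - powr_diff k e x) has_real_derivative
      e * powr_diff k (e - 1) (x + 1) - e * powr_diff k (e - 1) x) (at x)"
    by (intro DERIV_diff Suc.IH Suc.prems)
  then show ?case by (simp add: right_diff_distrib)
qed

text \<open>The mean value theorem trades one difference for one derivative, which brings out a
  factor and lowers the exponent by one. After k rounds a falling factorial times a positive power
  is left; hence the induction over all exponents at once.\<close>

lemma powr_diff_sign:
  "0 < x \<Longrightarrow> \<exists>c>0. powr_diff k e x = (\<Prod>i<k. e - real i) * c"
proof (induction k arbitrary: e x)
  case 0
  then show ?case by (intro exI[of _ "x powr e"]) simp
next
  case (Suc k)
  have "\<exists>z. x < z \<and> z < x + 1 \<and>
      powr_diff k e (x + 1) - powr_diff k e x = (x + 1 - x) * (e * powr_diff k (e - 1) z)"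
    using Suc.prems by (intro MVT2 powr_diff_has_real_derivative) auto
  then obtain z where z: "x < z" "powr_diff (Suc k) e x = e * powr_diff k (e - 1) z" by auto
  then obtain c where "c > 0" "powr_diff k (e - 1) z = (\<Prod>i<k. e - 1 - real i) * c"
    using Suc.IH[of z "e - 1"] Suc.prems by auto
  then show ?case
    using z by (intro exI[of _ c]) (simp add: prod.lessThan_Suc_shift algebra_simps del: prod.lessThan_Suc)
qed

lemma powr_diff_2_nonpos:
  assumes "0 < d" "d < 1" "0 < x"
  shows "powr_diff 2 d x \<le> 0"
proof -
  obtain c where "c > 0" "powr_diff 2 d x = (\<Prod>i<2. d - real i) * c"
    using powr_diff_sign[OF assms(3)] by blast
  then show ?thesis
    using assms by (simp add: numeral_eq_Suc mult_nonneg_nonpos mult_nonpos_nonneg)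
qed

lemma powr_diff_3_nonneg:
  assumes "0 < d" "d < 1" "0 < x"
  shows "powr_diff 3 d x \<ge> 0"
proof -
  obtain c where "c > 0" "powr_diff 3 d x = (\<Prod>i<3. d - real i) * c"
    using powr_diff_sign[OF assms(3)] by blast
  then show ?thesis
    using assms by (simp add: numeral_eq_Suc mult_nonneg_nonpos mult_nonpos_nonpos)
qed

lemma powr_diff_4_nonpos:
  assumes "0 < d" "d < 1" "0 < x"
  shows "powr_diff 4 d x \<le> 0"
proof -
  obtain c where "c > 0" "powr_diff 4 d x = (\<Prod>i<4. d - real i) * c"
    using powr_diff_sign[OF assms(3)] by blast
  then show ?thesis
    using assms by (simp add: numeral_eq_Suc mult_nonneg_nonpos mult_nonpos_nonneg mult_nonpos_nonpos)
qed

section \<open>Sign, monotonicity and partial sums of the coefficients of H(T_n)\<close>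

definition sym_coeff :: "real \<Rightarrow> nat \<Rightarrow> real" where
  "sym_coeff d k = (toep_coeff d (int k) + toep_coeff d (- int k)) / 2"

lemma sym_coeff_0: "sym_coeff d 0 = q_coeff d 1"
  and sym_coeff_1: "sym_coeff d 1 = (q_coeff d 0 + q_coeff d 2) / 2"
  by (simp_all add: sym_coeff_def toep_coeff_def numeral_2_eq_2)

lemma sym_coeff_ge_2: "2 \<le> k \<Longrightarrow> sym_coeff d k = q_coeff d (k + 1) / 2"
  by (simp add: sym_coeff_def toep_coeff_def nat_add_distrib)

lemma s_coeff_ge_2: "2 \<le> k \<Longrightarrow> s_coeff d k = powr_diff 2 d (real k - 3/2)"
  by (simp add: s_coeff_def numeral_2_eq_2 algebra_simps)

text \<open>From k = 2 on all four nodes are positive, so the truncation is invisible and the sign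
  lemmas for differences apply. The coefficients at 0 and 1 need separate arguments.\<close>

lemma sym_coeff_conv_powr_diff:
  assumes "2 \<le> k" shows "sym_coeff d k = - powr_diff 3 d (real k - 3/2) / 2"
proof -
  have "q_coeff d (k + 1) = s_coeff d k - s_coeff d (Suc k)" by (simp add: q_coeff_def)
  also have "\<dots> = - powr_diff 3 d (real k - 3/2)"
    using assms by (simp add: s_coeff_ge_2 numeral_3_eq_3 numeral_2_eq_2 algebra_simps)
  finally show ?thesis using assms by (simp add: sym_coeff_ge_2)
qed

text \<open>Dividing by (3/2)^\<delta> leaves a function convex in \<delta> that vanishes at \<delta> = 1; its tangent there is
  decreasing because (5/3)^2 \<le> 3.\<close>

lemma half_odd_powr_inequality:
  fixes d :: real
  assumes d: "0 < d" "d < 1"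
  shows "5 * (3/2) powr d \<le> 5 * (1/2) powr d + 2 * (5/2) powr d"
proof -
  have "2 * ln (5/3) = ln ((5/3) ^ 2 :: real)" by (subst ln_realpow) auto
  also have "\<dots> \<le> ln 3" by (subst ln_le_cancel_iff) (auto simp: power2_eq_square)
  finally have l: "2 * ln (5/3) \<le> ln (3::real)" .
  have "1 + (1 - d) * ln 3 \<le> exp ((1 - d) * ln 3)" by (rule exp_ge_add_one_self)
  also have "\<dots> = 3 powr (1 - d)" by (simp add: powr_def)
  finally have 1: "1 + (1 - d) * ln 3 \<le> 3 powr (1 - d)" .
  have "1 + (d - 1) * ln (5/3) \<le> exp ((d - 1) * ln (5/3))" by (rule exp_ge_add_one_self)
  also have "\<dots> = (5/3) powr (d - 1)" by (simp add: powr_def)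
  finally have 2: "1 + (d - 1) * ln (5/3) \<le> (5/3) powr (d - 1)" .
  have "(1 - d) * (2 * ln (5/3)) \<le> (1 - d) * ln 3" using d l by (intro mult_left_mono) auto
  then have 3: "5 \<le> 5/3 * 3 powr (1 - d) + 10/3 * (5/3) powr (d - 1)"
    using 1 2 by (simp add: algebra_simps)
  have "3 * (1/2) powr d = 3 powr (1 - d) * (3/2) powr d"
    by (simp add: powr_diff powr_divide)
  moreover have "(5/2) powr d = 5/3 * (5/3) powr (d - 1) * (3/2) powr d"
    by (simp add: powr_diff powr_divide)
  moreover have "5 * (3/2) powr d \<le> (5/3 * 3 powr (1 - d) + 10/3 * (5/3) powr (d - 1)) * (3/2) powr d"
    using 3 by (intro mult_right_mono) auto
  ultimately show ?thesis by (simp add: algebra_simps)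
qed

text \<open>From k = 2 on the increment is minus half a fourth difference, whose sign is that of
  \<delta>(\<delta> - 1)(\<delta> - 2)(\<delta> - 3) < 0.\<close>

lemma sym_coeff_mono_Suc:
  assumes d: "0 < d" "d < 1" and k: "1 \<le> k"
  shows "sym_coeff d k \<le> sym_coeff d (Suc k)"
proof (cases "k = 1")
  case True
  \<comment> \<open>Here the superdiagonal q_0 spoils the pattern of a fourth difference. Instead
    q_3 - q_0 - q_2 is minus this second difference plus the gap in
    \<open>half_odd_powr_inequality\<close>.\<close>
  have "(7/2) powr d - 2 * (5/2) powr d + (3/2) powr d \<le> 0"
    using powr_diff_2_nonpos[OF d, of "3/2"] by (simp add: numeral_2_eq_2)
  then show ?thesis
    using half_odd_powr_inequality[OF d] unfolding True
    by (simp add: sym_coeff_1[unfolded One_nat_def] sym_coeff_ge_2 q_coeff_def s_coeff_def)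
next
  case False
  with k have k: "k \<ge> 2" by simp
  have "powr_diff 4 d (real k - 3/2) = powr_diff 3 d (real (Suc k) - 3/2) - powr_diff 3 d (real k - 3/2)"
    using powr_diff.simps(2)[of 3 d "real k - 3/2"] by (simp add: algebra_simps del: powr_diff.simps)
  then have "sym_coeff d (Suc k) - sym_coeff d k = - powr_diff 4 d (real k - 3/2) / 2"
    using k by (simp add: sym_coeff_conv_powr_diff)
  moreover have "powr_diff 4 d (real k - 3/2) \<le> 0"
    using k by (intro powr_diff_4_nonpos d) simp
  ultimately show ?thesis by simp
qed

lemma sym_coeff_mono:
  assumes d: "0 < d" "d < 1" and k: "1 \<le> k" "k \<le> l"
  shows "sym_coeff d k \<le> sym_coeff d l"
  using k(2)
proof (induction l rule: dec_induct)
  case (step l)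
  have "sym_coeff d l \<le> sym_coeff d (Suc l)" using k(1) step.hyps by (intro sym_coeff_mono_Suc d) simp
  with step.IH show ?case by simp
qed simp

lemma sym_coeff_nonpos:
  assumes d: "0 < d" "d < 1" and k: "1 \<le> k"
  shows "sym_coeff d k \<le> 0"
proof -
  \<comment> \<open>Moving up by one reaches an index of at least 2, where the coefficient is minus
    half a third difference; this includes k = 1.\<close>
  have "sym_coeff d k \<le> sym_coeff d (k + 1)" by (intro sym_coeff_mono d k) auto
  also have "\<dots> \<le> 0"
    using k powr_diff_3_nonneg[OF d, of "real (k + 1) - 3/2"]
    by (simp add: sym_coeff_conv_powr_diff)
  finally show ?thesis .
qed

text \<open>The q are differences of the s, so the sum telescopes to -s_(K+1), minus a second
  difference of a concave power. For K = 0 the coefficient q_0 has not entered yet, and the claim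
  comes down to 3^\<delta> \<le> 3.\<close>

lemma sym_coeff_partial_sum_nonneg:
  assumes d: "0 < d" "d < 1"
  shows "0 \<le> sym_coeff d 0 + 2 * (\<Sum>k = 1..K. sym_coeff d k)"
proof (cases "K = 0")
  case True
  have "3 powr d \<le> (3::real) powr 1" using d by (intro powr_mono) auto
  then have "3 powr d * (1/2) powr d \<le> 3 * (1/2 :: real) powr d"
    by (intro mult_right_mono) auto
  then show ?thesis
    using True by (simp add: sym_coeff_0 q_coeff_def s_coeff_def powr_mult[symmetric])
next
  case False
  then have "1 \<le> K" by simp
  then have "sym_coeff d 0 + 2 * (\<Sum>k = 1..K. sym_coeff d k) = - s_coeff d (Suc K)"
  proof (induction K rule: dec_induct)
    case base
    show ?case using sym_coeff_0[of d] sym_coeff_1[of d] by (simp add: q_coeff_def numeral_2_eq_2)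
  next
    case (step K)
    have "2 * sym_coeff d (Suc K) = s_coeff d (Suc K) - s_coeff d (Suc (Suc K))"
      using step.hyps by (simp add: sym_coeff_ge_2 q_coeff_def)
    with step.IH show ?case by simp
  qed
  moreover have "s_coeff d (Suc K) \<le> 0"
    using powr_diff_2_nonpos[OF d, of "real (Suc K) - 3/2"] \<open>1 \<le> K\<close> by (simp add: s_coeff_ge_2)
  ultimately show ?thesis by simp
qed

section \<open>The sine transform of a symmetric Toeplitz matrix\<close>

lemma sum_cos_multiples_full:
  fixes p :: int and K :: nat
  assumes "0 < K"
  shows "(\<Sum>l<2*K. cos (real_of_int p * real l * pi / real K)) = (if 2 * int K dvd p then 2 * real K else 0)"
proof -
  define z where "z = cis (real_of_int p * pi / real K)"
  have "(\<Sum>l<2*K. cos (real_of_int p * real l * pi / real K)) = Re (\<Sum>l<2*K. z ^ l)"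
    unfolding z_def Complex.DeMoivre Re_sum by (intro sum.cong refl) (simp add: mult_ac)
  also have "\<dots> = (if 2 * int K dvd p then 2 * real K else 0)"
  proof (cases "2 * int K dvd p")
    case True
    then obtain q where "p = 2 * int K * q" by auto
    then have "real_of_int p * pi / real K = 2 * pi * of_int q" using assms by simp
    then have "z = 1" unfolding z_def by (simp add: cis_multiple_2pi)
    then show ?thesis using True by simp
  next
    case False
    have "z \<noteq> 1"
    proof
      assume "z = 1"
      then have "cos (real_of_int p * pi / real K) = 1" by (simp add: z_def complex_eq_iff)
      then obtain q :: int where "real_of_int p * pi / real K = of_int q * 2 * pi"
        unfolding cos_one_2pi_int by blast
      then have "real_of_int p = of_int (2 * int K * q)" using assms by (simp add: field_simps)
      then have "p = 2 * int K * q" by (simp only: of_int_eq_iff)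
      with False show False by simp
    qed
    moreover have "z ^ (2*K) = cis (2 * pi * of_int p)"
      unfolding z_def Complex.DeMoivre using assms by (simp add: field_simps)
    then have "z ^ (2*K) = 1" by (simp add: cis_multiple_2pi)
    ultimately show ?thesis using False by (simp add: geometric_sum)
  qed
  finally show ?thesis .
qed

text \<open>The reflection of l to 2K - l folds the sum over a full period. The fixed terms l = 0
  and l = K, with values 1 and (-1)^p, are the two corrections.\<close>

lemma sum_cos_multiples:
  fixes p :: int and n :: nat
  shows "2 * (\<Sum>l<n. cos (real_of_int p * (real (l + 1) * pi / (real n + 1)))) =
    2 * (real n + 1) * of_bool (2 * (int n + 1) dvd p) - 1 - (if even p then 1 else - 1)"
proof -
  define K where "K = n + 1"
  define f where "f l = cos (real_of_int p * real l * pi / real K)" for l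
  have K: "K > 0" "real K = real n + 1" by (simp_all add: K_def)
  have "{..<2*K} = insert 0 (insert K ({1..n} \<union> {K+1..<2*K}))" by (auto simp: K_def)
  moreover have "0 \<notin> insert K ({1..n} \<union> {K+1..<2*K})" "K \<notin> {1..n} \<union> {K+1..<2*K}"
    by (auto simp: K_def)
  moreover have "sum f ({1..n} \<union> {K+1..<2*K}) = sum f {1..n} + sum f {K+1..<2*K}"
    by (rule sum.union_disjoint) (auto simp: K_def)
  ultimately have "(\<Sum>l<2*K. f l) = f 0 + (f K + (sum f {1..n} + sum f {K+1..<2*K}))"
    by simp
  also have "sum f {K+1..<2*K} = sum f {1..n}"
  proof (rule sum.reindex_bij_witness[of _ "\<lambda>l. 2*K - l" "\<lambda>l. 2*K - l"])
    fix l assume "l \<in> {K+1..<2*K}"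
    then have "real (2*K - l) = 2 * real K - real l" by (simp add: of_nat_diff)
    then have "real_of_int p * real (2*K - l) * pi / real K = 2 * pi * real_of_int p - real_of_int p * real l * pi / real K"
      using K by (simp add: field_simps)
    then show "f (2*K - l) = f l"
      unfolding f_def by (simp only:) (simp add: cos_diff)
  qed (auto simp: K_def)
  also have "sum f {1..n} = (\<Sum>l<n. f (l + 1))"
    by (rule sum.reindex_bij_witness[of _ "\<lambda>l. l + 1" "\<lambda>l. l - 1"]) auto
  also have "f 0 = 1" by (simp add: f_def)
  also have "f K = (if even p then 1 else - 1)"
    using K by (simp add: f_def cos_int_times_real mult.commute)
  finally show ?thesis
    using sum_cos_multiples_full[OF K(1), of p] unfolding f_def K_def by (simp add: algebra_simps of_bool_def)
qed

lemma sin_sin_cos_expand: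
  fixes a b c :: real
  shows "2 * sin a * sin b * (2 * cos c) = cos (a - b + c) + cos (a - b - c) - cos (a + b + c) - cos (a + b - c)"
  by (simp add: cos_add cos_diff sin_add sin_diff algebra_simps)

text \<open>Expanding the product gives four cosine sums. The two positive ones have the same
  parities as the two negative ones, so the corrections cancel and only the divisibility indicators
  survive.\<close>

lemma sine_product_sum:
  fixes i j m n :: nat
  assumes "i < n" "j < n"
  defines "x \<equiv> \<lambda>l. real (l + 1) * pi / (real n + 1)"
  shows "(\<Sum>l<n. 2 * sin (real (i + 1) * x l) * sin (real (j + 1) * x l) * (2 * cos (real m * x l))) =
    (real n + 1) * (of_bool (2 * (int n + 1) dvd int i - int j + int m) + of_bool (2 * (int n + 1) dvd int i - int j - int m)
      - of_bool (2 * (int n + 1) dvd int i + int j + 2 + int m) - of_bool (2 * (int n + 1) dvd int i + int j + 2 - int m))"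
proof -
  define C where "C p = (\<Sum>l<n. cos (real_of_int p * x l))" for p
  have C: "2 * C p = 2 * (real n + 1) * of_bool (2 * (int n + 1) dvd p) - 1 - (if even p then 1 else - 1)" for p
    unfolding C_def x_def by (rule sum_cos_multiples)
  have "2 * sin (real (i + 1) * x l) * sin (real (j + 1) * x l) * (2 * cos (real m * x l)) =
      cos (real_of_int (int i - int j + int m) * x l) + cos (real_of_int (int i - int j - int m) * x l)
      - cos (real_of_int (int i + int j + 2 + int m) * x l) - cos (real_of_int (int i + int j + 2 - int m) * x l)" for l
    by (simp only: sin_sin_cos_expand) (simp add: algebra_simps)
  then have "(\<Sum>l<n. 2 * sin (real (i + 1) * x l) * sin (real (j + 1) * x l) * (2 * cos (real m * x l))) =
      C (int i - int j + int m) + C (int i - int j - int m) - C (int i + int j + 2 + int m) - C (int i + int j + 2 - int m)"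
    by (simp only: C_def sum.distrib sum_subtractf)
  moreover have "even (int i - int j + int m) = even (int i + int j + 2 + int m)"
    "even (int i - int j - int m) = even (int i + int j + 2 - int m)"
    by presburger+
  ultimately show ?thesis
    using C[of "int i - int j + int m"] C[of "int i - int j - int m"]
      C[of "int i + int j + 2 + int m"] C[of "int i + int j + 2 - int m"]
    by (simp add: algebra_simps split: if_splits)
qed

lemma dvd_small_iff:
  fixes p K :: int
  assumes "\<bar>p\<bar> < K" shows "K dvd p \<longleftrightarrow> p = 0"
  using assms dvd_imp_le_int[of p K] by auto

lemma dvd_below_twice_iff:
  fixes p K :: int
  assumes "0 < p" "p < 2 * K" shows "K dvd p \<longleftrightarrow> p = K"
proof -
  have "K dvd p \<longleftrightarrow> K dvd p - K" using dvd_add_left_iff[of K K "p - K"] by simp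
  also have "\<dots> \<longleftrightarrow> p - K = 0" using assms by (intro dvd_small_iff) auto
  finally show ?thesis by simp
qed

text \<open>Written as a sum of indicators over m, parallel to \<open>hankel_entry\<close>, so that
  the sine transform and the row sums can be compared coefficient by coefficient.\<close>

definition toeplitz_entry :: "(nat \<Rightarrow> real) \<Rightarrow> nat \<Rightarrow> nat \<Rightarrow> nat \<Rightarrow> real" where
  "toeplitz_entry t n i j = t 0 * of_bool (i = j)
    + (\<Sum>m = 1..n - 1. t m * (of_bool (m + j = i) + of_bool (m + i = j)))"

text \<open>With indices counted from 1 the entry is t_(i+j) in the upper left corner and
  t_(2(n+1)-i-j) in the lower right one, where t is cut off after n - 1.\<close>

definition hankel_entry :: "(nat \<Rightarrow> real) \<Rightarrow> nat \<Rightarrow> nat \<Rightarrow> nat \<Rightarrow> real" where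
  "hankel_entry t n i j = (\<Sum>m = 1..n - 1. t m * (of_bool (m = i + j + 2) + of_bool (m + i + j = 2 * n)))"

lemma sine_product_sum_indicator:
  fixes i j m n :: nat
  assumes ij: "i < n" "j < n" and m: "1 \<le> m" "m \<le> n - 1"
  defines "x \<equiv> \<lambda>l. real (l + 1) * pi / (real n + 1)"
  shows "(\<Sum>l<n. 2 * sin (real (i + 1) * x l) * sin (real (j + 1) * x l) * (2 * cos (real m * x l))) =
    (real n + 1) * (of_bool (m + j = i) + of_bool (m + i = j) - of_bool (m = i + j + 2) - of_bool (m + i + j = 2 * n))"
proof -
  have "(2 * (int n + 1) dvd int i - int j + int m) = (m + i = j)"
    using ij m by (subst dvd_small_iff) auto
  moreover have "(2 * (int n + 1) dvd int i - int j - int m) = (m + j = i)"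
    using ij m by (subst dvd_small_iff) auto
  moreover have "(2 * (int n + 1) dvd int i + int j + 2 + int m) = (m + i + j = 2 * n)"
    using ij m by (subst dvd_below_twice_iff) auto
  moreover have "(2 * (int n + 1) dvd int i + int j + 2 - int m) = (m = i + j + 2)"
    using ij m by (subst dvd_small_iff) auto
  ultimately show ?thesis
    unfolding x_def using sine_product_sum[OF ij, of m] by (simp add: algebra_simps)
qed

lemma sine_product_sum_0:
  fixes i j n :: nat
  assumes ij: "i < n" "j < n"
  defines "x \<equiv> \<lambda>l. real (l + 1) * pi / (real n + 1)"
  shows "(\<Sum>l<n. 2 * sin (real (i + 1) * x l) * sin (real (j + 1) * x l)) = (real n + 1) * of_bool (i = j)"
proof -
  have "(2 * (int n + 1) dvd int i - int j) = (i = j)"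
    using ij by (subst dvd_small_iff) auto
  moreover have "\<not> 2 * (int n + 1) dvd int i + int j + 2"
    using ij by (subst dvd_small_iff) auto
  ultimately show ?thesis
    using sine_product_sum[OF ij, of 0] unfolding x_def
    by (simp only: of_nat_0 mult_zero_left cos_zero mult_1_right sum_distrib_right[symmetric]) simp
qed

lemma mult_mat_entry:
  assumes "A \<in> carrier_mat n m" "B \<in> carrier_mat m p" "i < n" "j < p"
  shows "(A * B) $$ (i, j) = (\<Sum>l<m. A $$ (i, l) * B $$ (l, j))"
  using assms by (simp add: scalar_prod_def lessThan_atLeast0)

lemma sine_mat_carrier [simp]: "sine_mat n \<in> carrier_mat n n"
  by (simp add: sine_mat_def)

text \<open>Kept for arbitrary t because it is used three times: for the \<tau> matrices, for the
  involution property of the sine matrix and for the diagonalisation of A_n.\<close>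

lemma sine_diag_sine_entry:
  assumes ij: "i < n" "j < n"
  shows "(sine_mat n * mat_diag n (\<lambda>k. t 0 + 2 * (\<Sum>m = 1..n - 1. t m * cos (real m * real (k + 1) * pi / (real n + 1))))
      * sine_mat n) $$ (i, j) = toeplitz_entry t n i j - hankel_entry t n i j"
proof -
  define x where "x l = real (l + 1) * pi / (real n + 1)" for l :: nat
  define S where "S m = (\<Sum>l<n. 2 * sin (real (i + 1) * x l) * sin (real (j + 1) * x l) * (2 * cos (real m * x l)))" for m
  define S0 where "S0 = (\<Sum>l<n. 2 * sin (real (i + 1) * x l) * sin (real (j + 1) * x l))"
  let ?lam = "\<lambda>k. t 0 + 2 * (\<Sum>m = 1..n - 1. t m * cos (real m * real (k + 1) * pi / (real n + 1)))"
  have "(sine_mat n * mat_diag n ?lam * sine_mat n) $$ (i, j) =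
     (\<Sum>l<n. (sine_mat n * mat_diag n ?lam) $$ (i, l) * sine_mat n $$ (l, j))"
    by (rule mult_mat_entry[OF mult_carrier_mat[OF sine_mat_carrier mat_diag_dim] sine_mat_carrier ij])
  also have "\<dots> = (\<Sum>l<n. (sqrt (2 / (real n + 1)) * sin (real (i + 1) * x l)) * ?lam l * (sqrt (2 / (real n + 1)) * sin (real (j + 1) * x l)))"
    using ij by (intro sum.cong refl) (simp add: mat_diag_mult_right[of _ n n] sine_mat_def x_def mult_ac)
  also have "\<dots> = (\<Sum>l<n. 1 / (real n + 1) * (t 0 * (2 * sin (real (i + 1) * x l) * sin (real (j + 1) * x l))
      + (\<Sum>m = 1..n - 1. t m * (2 * sin (real (i + 1) * x l) * sin (real (j + 1) * x l) * (2 * cos (real m * x l))))))"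
  proof (intro sum.cong refl)
    fix l
    define a b where "a = sin (real (i + 1) * x l)" and "b = sin (real (j + 1) * x l)"
    have "sqrt (2 / (real n + 1)) * a * ?lam l * (sqrt (2 / (real n + 1)) * b) =
        (sqrt (2 / (real n + 1)) * sqrt (2 / (real n + 1))) * (a * b) * ?lam l" by (simp only: mult_ac)
    also have "sqrt (2 / (real n + 1)) * sqrt (2 / (real n + 1)) = 2 / (real n + 1)" by simp
    also have "2 / (real n + 1) * (a * b) * ?lam l = 1 / (real n + 1) * ((2 * a * b) * ?lam l)" by simp
    also have "(2 * a * b) * ?lam l = t 0 * (2 * a * b) + (\<Sum>m = 1..n - 1. t m * (2 * a * b * (2 * cos (real m * x l))))"
      unfolding x_def by (simp add: distrib_left sum_distrib_left mult_ac)
    finally show "sqrt (2 / (real n + 1)) * a * ?lam l * (sqrt (2 / (real n + 1)) * b) =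
      1 / (real n + 1) * (t 0 * (2 * a * b) + (\<Sum>m = 1..n - 1. t m * (2 * a * b * (2 * cos (real m * x l)))))" .
  qed
  also have "\<dots> = 1 / (real n + 1) * (t 0 * S0 + (\<Sum>m = 1..n - 1. t m * S m))"
    unfolding S_def S0_def sum_distrib_left[symmetric] sum.distrib
    by (subst sum.swap) (simp only: sum_distrib_left)
  also have "S0 = (real n + 1) * of_bool (i = j)"
    unfolding S0_def x_def by (rule sine_product_sum_0[OF ij])
  also have "(\<Sum>m = 1..n - 1. t m * S m) = (\<Sum>m = 1..n - 1. (real n + 1) *
      (t m * (of_bool (m + j = i) + of_bool (m + i = j)) - t m * (of_bool (m = i + j + 2) + of_bool (m + i + j = 2 * n))))"
    unfolding S_def x_def
    by (intro sum.cong refl, subst sine_product_sum_indicator[OF ij]) (auto simp: algebra_simps)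
  also have "1 / (real n + 1) * (t 0 * ((real n + 1) * of_bool (i = j)) + \<dots>) = toeplitz_entry t n i j - hankel_entry t n i j"
    unfolding toeplitz_entry_def hankel_entry_def sum_distrib_left[symmetric] sum_subtractf
    by (simp add: field_simps)
  finally show ?thesis .
qed

lemma transpose_sine_mat: "transpose_mat (sine_mat n) = sine_mat n"
  by (rule eq_matI) (auto simp: sine_mat_def mult_ac)

lemma sine_mat_involution: "sine_mat n * sine_mat n = 1\<^sub>m n"
proof (rule eq_matI)
  fix i j assume "i < dim_row (1\<^sub>m n)" "j < dim_col (1\<^sub>m n)"
  then have ij: "i < n" "j < n" by auto
  \<comment> \<open>For this t all eigenvalues are 1 and the Hankel part vanishes.\<close>
  define t :: "nat \<Rightarrow> real" where "t k = of_bool (k = 0)" for k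
  have "mat_diag n (\<lambda>k. t 0 + 2 * (\<Sum>m = 1..n - 1. t m * cos (real m * real (k + 1) * pi / (real n + 1)))) = 1\<^sub>m n"
    by (rule eq_matI) (auto simp: t_def intro!: sum.neutral)
  then show "(sine_mat n * sine_mat n) $$ (i, j) = 1\<^sub>m n $$ (i, j)"
    using sine_diag_sine_entry[OF ij, of t] ij
    by (simp add: toeplitz_entry_def hankel_entry_def t_def right_mult_one_mat[OF sine_mat_carrier] cong: sum.cong)
qed (auto simp: sine_mat_def)

lemma toeplitz_entry_conv:
  assumes "i < n" "j < n"
  shows "toeplitz_entry t n i j = t (if j \<le> i then i - j else j - i)"
proof (cases i j rule: linorder_cases)
  case equal
  then show ?thesis by (simp add: toeplitz_entry_def)
next
  case less
  have "(\<Sum>m = 1..n - 1. t m * (of_bool (m + j = i) + of_bool (m + i = j))) =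
      (\<Sum>m = 1..n - 1. if m = j - i then t m else 0)"
    using less by (intro sum.cong) auto
  then show ?thesis using less assms unfolding toeplitz_entry_def by (simp only: sum.delta) auto
next
  case greater
  have "(\<Sum>m = 1..n - 1. t m * (of_bool (m + j = i) + of_bool (m + i = j))) =
      (\<Sum>m = 1..n - 1. if m = i - j then t m else 0)"
    using greater by (intro sum.cong) auto
  then show ?thesis using greater assms unfolding toeplitz_entry_def by (simp only: sum.delta) auto
qed

lemma hankel_entry_conv:
  assumes "i < n" "j < n"
  shows "hankel_entry t n i j = (if i + j + 2 < n then t (i + j + 2) else if n < i + j then t (2 * n - (i + j)) else 0)"
proof -
  have "(\<Sum>m = 1..n - 1. t m * (of_bool (m = i + j + 2) + of_bool (m + i + j = 2 * n))) =
    (\<Sum>m = 1..n - 1. if m = i + j + 2 then t m else 0) + (\<Sum>m = 1..n - 1. if m = 2 * n - (i + j) then t m else 0)"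
    unfolding sum.distrib[symmetric] using assms by (intro sum.cong) (auto simp: algebra_simps)
  then show ?thesis using assms by (auto simp: hankel_entry_def)
qed

section \<open>Diagonal dominance\<close>

text \<open>Vectors are plain functions here, so the slices of a vector that arise from Kronecker
  products are ordinary terms.\<close>

definition qform :: "real mat \<Rightarrow> (nat \<Rightarrow> complex) \<Rightarrow> complex" where
  "qform Z x = (\<Sum>i<dim_row Z. \<Sum>j<dim_row Z. cnj (x i) * of_real (Z $$ (i, j)) * x j)"

text \<open>The row sum includes the diagonal entry, so \<open>2 * M i i\<close> expresses ordinary
  diagonal dominance. An off-diagonal term is at least -|M_ij| (|x_i|^2 + |x_j|^2) / 2, and by
  symmetry the half with x_j can be charged to row j.\<close>

lemma diag_dominant_form_nonneg:
  fixes M :: "nat \<Rightarrow> nat \<Rightarrow> real" and x :: "nat \<Rightarrow> complex"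
  assumes sym: "\<And>i j. i < n \<Longrightarrow> j < n \<Longrightarrow> M i j = M j i"
    and diag: "\<And>i. i < n \<Longrightarrow> 0 \<le> M i i"
    and dom: "\<And>i. i < n \<Longrightarrow> (\<Sum>j<n. \<bar>M i j\<bar>) \<le> 2 * M i i"
  shows "0 \<le> Re (\<Sum>i<n. \<Sum>j<n. cnj (x i) * of_real (M i j) * x j)"
proof -
  let ?N = "\<lambda>i. (cmod (x i))\<^sup>2"
  have "0 \<le> (\<Sum>i<n. ?N i * (2 * M i i - (\<Sum>j<n. \<bar>M i j\<bar>)))"
    using dom by (intro sum_nonneg mult_nonneg_nonneg) auto
  also have "\<dots> = (\<Sum>i<n. ?N i * (2 * M i i)) - (\<Sum>i<n. \<Sum>j<n. \<bar>M i j\<bar> * ?N i)"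
    by (simp add: right_diff_distrib sum_subtractf sum_distrib_left mult_ac)
  also have "(\<Sum>i<n. \<Sum>j<n. \<bar>M i j\<bar> * ?N i) = (\<Sum>i<n. \<Sum>j<n. \<bar>M i j\<bar> * ((?N i + ?N j) / 2))"
  proof -
    have "(\<Sum>i<n. \<Sum>j<n. \<bar>M i j\<bar> * ?N j) = (\<Sum>i<n. \<Sum>j<n. \<bar>M i j\<bar> * ?N i)"
      by (subst sum.swap) (intro sum.cong refl, simp add: sym)
    then show ?thesis
      by (simp add: distrib_left add_divide_distrib sum.distrib sum_divide_distrib[symmetric])
  qed
  also have "(\<Sum>i<n. ?N i * (2 * M i i)) = (\<Sum>i<n. \<Sum>j<n. if j = i then 2 * M i i * ?N i else 0)"
    by (simp add: mult_ac)
  also have "\<dots> - (\<Sum>i<n. \<Sum>j<n. \<bar>M i j\<bar> * ((?N i + ?N j) / 2)) =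
      (\<Sum>i<n. \<Sum>j<n. (if j = i then 2 * M i i * ?N i else 0) - \<bar>M i j\<bar> * ((?N i + ?N j) / 2))"
    by (simp add: sum_subtractf)
  also have "\<dots> \<le> (\<Sum>i<n. \<Sum>j<n. Re (cnj (x i) * of_real (M i j) * x j))"
  proof (intro sum_mono)
    fix i j assume ij: "i \<in> {..<n}" "j \<in> {..<n}"
    show "(if j = i then 2 * M i i * ?N i else 0) - \<bar>M i j\<bar> * ((?N i + ?N j) / 2)
        \<le> Re (cnj (x i) * of_real (M i j) * x j)"
    proof (cases "j = i")
      case True
      have "Re (cnj (x i) * of_real (M i i) * x i) = M i i * ?N i"
        unfolding cmod_power2 by (simp add: power2_eq_square algebra_simps)
      then show ?thesis using diag[of i] ij True by simp
    next
      case False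
      have "\<bar>Re (cnj (x i) * of_real (M i j) * x j)\<bar> \<le> cmod (cnj (x i) * of_real (M i j) * x j)"
        by (rule abs_Re_le_cmod)
      also have "\<dots> = \<bar>M i j\<bar> * (cmod (x i) * cmod (x j))" by (simp add: norm_mult)
      also have "\<dots> \<le> \<bar>M i j\<bar> * ((?N i + ?N j) / 2)"
        using sum_squares_bound[of "cmod (x i)" "cmod (x j)"] by (intro mult_left_mono) auto
      finally have "\<bar>Re (cnj (x i) * of_real (M i j) * x j)\<bar> \<le> \<bar>M i j\<bar> * ((?N i + ?N j) / 2)" .
      from abs_le_D2[OF this] show ?thesis unfolding if_not_P[OF False] by linarith
    qed
  qed
  finally show ?thesis by (simp add: Re_sum)
qed

lemma sum_of_bool_eq:
  fixes P :: "nat \<Rightarrow> bool"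
  assumes "\<And>j. j < n \<Longrightarrow> P j \<longleftrightarrow> Q \<and> j = a" "Q \<Longrightarrow> a < n"
  shows "(\<Sum>j<n. of_bool (P j)) = (of_bool Q :: real)"
proof -
  have "(\<Sum>j<n. of_bool (P j) :: real) = (\<Sum>j<n. if j = a then of_bool Q else 0)"
    using assms(1) by (intro sum.cong) (auto simp: of_bool_def)
  then show ?thesis using assms(2) by auto
qed

text \<open>The only facts about fractional powers that enter the comparison of a Toeplitz matrix
  with its \<tau> matrix. They are stable under nonnegative scaling, so they pass from T_n to
  B_n.\<close>

locale tau_dominance =
  fixes t :: "nat \<Rightarrow> real" and n :: nat
  assumes nonpos: "\<And>k. 1 \<le> k \<Longrightarrow> t k \<le> 0"
    and mono: "\<And>k l. 1 \<le> k \<Longrightarrow> k \<le> l \<Longrightarrow> t k \<le> t l"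
    and sum_nonneg: "0 \<le> t 0 + 2 * (\<Sum>k = 1..n - 1. t k)"
begin

abbreviation "tau_entry i j \<equiv> toeplitz_entry t n i j - hankel_entry t n i j"

lemma hankel_nonpos: "i < n \<Longrightarrow> j < n \<Longrightarrow> hankel_entry t n i j \<le> 0"
  by (auto simp: hankel_entry_conv intro!: nonpos)

lemma t0_nonneg: "0 \<le> t 0"
  using sum_nonneg sum_nonpos[of "{1..n - 1}" t] nonpos by auto

lemma tau_entry_diag_nonneg: "i < n \<Longrightarrow> 0 \<le> tau_entry i i"
  using t0_nonneg hankel_nonpos[of i i] by (simp add: toeplitz_entry_conv)

text \<open>Both Hankel indices, i + j + 2 and 2n - (i + j), are at least |i - j|. By monotonicity
  the Hankel entry is no smaller than the Toeplitz entry from which it is subtracted.\<close>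

lemma tau_entry_offdiag_nonpos:
  assumes "i < n" "j < n" "i \<noteq> j"
  shows "tau_entry i j \<le> 0"
proof -
  have "t (if j \<le> i then i - j else j - i) \<le> hankel_entry t n i j"
    using assms by (auto simp: hankel_entry_conv intro!: mono nonpos)
  then show ?thesis using assms by (simp add: toeplitz_entry_conv)
qed

text \<open>In one row of Toeplitz plus Hankel part each t_m occurs at most twice: m \<le> i
  excludes m \<ge> i + 2, and m + i < n excludes m + i > n. As t_m \<le> 0, the row sum is at least
  t_0 plus twice the sum of the others.\<close>

lemma row_sum_nonneg:
  assumes i: "i < n"
  shows "0 \<le> (\<Sum>j<n. toeplitz_entry t n i j + hankel_entry t n i j)"
proof -
  let ?c = "\<lambda>m. (of_bool (m \<le> i) + of_bool (m + i < n)) + (of_bool (i + 2 \<le> m) + of_bool (n < m + i)) :: real"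
  have "(\<Sum>k = 1..n - 1. t k * 2) \<le> (\<Sum>m = 1..n - 1. t m * ?c m)"
  proof (intro sum_mono mult_left_mono_neg)
    fix m assume m: "m \<in> {1..n - 1}"
    show "?c m \<le> 2" by (auto simp: of_bool_def)
    show "t m \<le> 0" using m by (intro nonpos) auto
  qed
  also have "\<dots> = (\<Sum>m = 1..n - 1. t m * (\<Sum>j<n. (of_bool (m + j = i) + of_bool (m + i = j))
      + (of_bool (m = i + j + 2) + of_bool (m + i + j = 2 * n))))"
  proof (intro sum.cong refl arg_cong[of _ _ "(*) _"])
    fix m assume m: "m \<in> {1..n - 1}"
    have "(\<Sum>j<n. of_bool (m + j = i)) = (of_bool (m \<le> i) :: real)"
      using i by (intro sum_of_bool_eq[where a = "i - m"]) auto
    moreover have "(\<Sum>j<n. of_bool (m + i = j)) = (of_bool (m + i < n) :: real)"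
      by (intro sum_of_bool_eq[where a = "m + i"]) auto
    moreover have "(\<Sum>j<n. of_bool (m = i + j + 2)) = (of_bool (i + 2 \<le> m) :: real)"
      using m by (intro sum_of_bool_eq[where a = "m - i - 2"]) auto
    moreover have "(\<Sum>j<n. of_bool (m + i + j = 2 * n)) = (of_bool (n < m + i) :: real)"
      using i m by (intro sum_of_bool_eq[where a = "2 * n - m - i"]) auto
    ultimately show "?c m = (\<Sum>j<n. (of_bool (m + j = i) + of_bool (m + i = j))
      + (of_bool (m = i + j + 2) + of_bool (m + i + j = 2 * n)))"
      by (simp only: sum.distrib)
  qed
  also have "t 0 + \<dots> = (\<Sum>j<n. toeplitz_entry t n i j + hankel_entry t n i j)"
  proof -
    have "(\<Sum>j<n. t 0 * of_bool (i = j)) = t 0" using i by (simp add: sum_distrib_left[symmetric] sum_of_bool_eq[where a = i and Q = True])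
    moreover have "(\<Sum>m = 1..n - 1. t m * (\<Sum>j<n. (of_bool (m + j = i) + of_bool (m + i = j))
      + (of_bool (m = i + j + 2) + of_bool (m + i + j = 2 * n)))) =
      (\<Sum>j<n. (\<Sum>m = 1..n - 1. t m * (of_bool (m + j = i) + of_bool (m + i = j)))
        + (\<Sum>m = 1..n - 1. t m * (of_bool (m = i + j + 2) + of_bool (m + i + j = 2 * n))))"
      unfolding sum_distrib_left sum.distrib[symmetric] distrib_left[symmetric] by (rule sum.swap)
    ultimately show ?thesis
      unfolding toeplitz_entry_def hankel_entry_def by (simp add: sum.distrib add.assoc)
  qed
  finally show ?thesis using sum_nonneg by (simp add: sum_distrib_right[symmetric])
qed

lemma tau_abs_row_sum:
  assumes i: "i < n"
  shows "(\<Sum>j<n. \<bar>tau_entry i j\<bar>) = 2 * tau_entry i i - (\<Sum>j<n. tau_entry i j)"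
proof -
  have "(\<Sum>j<n. \<bar>tau_entry i j\<bar>) = (\<Sum>j<n. (if j = i then 2 * tau_entry i i else 0) - tau_entry i j)"
    using i tau_entry_diag_nonneg tau_entry_offdiag_nonpos
    by (intro sum.cong refl) (auto simp: abs_of_nonpos abs_of_nonneg)
  then show ?thesis using i by (simp add: sum_subtractf)
qed

lemma entry_sym:
  assumes "i < n" "j < n"
  shows "toeplitz_entry t n i j = toeplitz_entry t n j i" "hankel_entry t n i j = hankel_entry t n j i"
  using assms by (auto simp: toeplitz_entry_conv hankel_entry_conv add.commute)

lemma tau_form_nonneg:
  "0 \<le> Re (\<Sum>i<n. \<Sum>j<n. cnj (x i) * of_real (tau_entry i j) * x j)"
proof (rule diag_dominant_form_nonneg)
  fix i assume i: "i < n"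
  have "(\<Sum>j<n. toeplitz_entry t n i j + hankel_entry t n i j) \<le> (\<Sum>j<n. tau_entry i j)"
    using hankel_nonpos i by (intro sum_mono) fastforce
  then show "(\<Sum>j<n. \<bar>tau_entry i j\<bar>) \<le> 2 * tau_entry i i"
    unfolding tau_abs_row_sum[OF i] using row_sum_nonneg[OF i] by simp
qed (use entry_sym tau_entry_diag_nonneg in auto)

lemma toeplitz_form_le_tau_form:
  "Re (\<Sum>i<n. \<Sum>j<n. cnj (x i) * of_real (toeplitz_entry t n i j) * x j)
    \<le> 3/2 * Re (\<Sum>i<n. \<Sum>j<n. cnj (x i) * of_real (tau_entry i j) * x j)"
proof -
  let ?M = "\<lambda>i j. 1/2 * tau_entry i j - hankel_entry t n i j"
  have "0 \<le> Re (\<Sum>i<n. \<Sum>j<n. cnj (x i) * of_real (?M i j) * x j)"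
  proof (rule diag_dominant_form_nonneg)
    fix i assume i: "i < n"
    show "0 \<le> ?M i i" using tau_entry_diag_nonneg[OF i] hankel_nonpos[OF i i] by simp
    have "(\<Sum>j<n. \<bar>?M i j\<bar>) \<le> (\<Sum>j<n. 1/2 * \<bar>tau_entry i j\<bar> - hankel_entry t n i j)"
    proof (intro sum_mono)
      fix j assume "j \<in> {..<n}"
      then have "hankel_entry t n i j \<le> 0" using hankel_nonpos[OF i] by simp
      moreover have "\<bar>1/2 * a - h\<bar> \<le> 1/2 * \<bar>a\<bar> - h" if "h \<le> 0" for a h :: real
        using that by (auto simp: abs_if)
      ultimately show "\<bar>?M i j\<bar> \<le> 1/2 * \<bar>tau_entry i j\<bar> - hankel_entry t n i j" by blast
    qed
    also have "\<dots> = 1/2 * (2 * tau_entry i i - (\<Sum>j<n. tau_entry i j)) - (\<Sum>j<n. hankel_entry t n i j)"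
      unfolding tau_abs_row_sum[OF i, symmetric] by (simp add: sum_subtractf sum_divide_distrib)
    \<comment> \<open>The weight 1/2 makes half of the \<tau> row sum plus the Hankel row sum equal
      to half of the sum controlled by \<open>row_sum_nonneg\<close>.\<close>
    also have "\<dots> = tau_entry i i - 1/2 * (\<Sum>j<n. toeplitz_entry t n i j + hankel_entry t n i j)"
      by (simp add: sum_subtractf sum.distrib field_simps)
    also have "\<dots> \<le> tau_entry i i" using row_sum_nonneg[OF i] by simp
    also have "\<dots> \<le> 2 * ?M i i" using hankel_nonpos[OF i i] by simp
    finally show "(\<Sum>j<n. \<bar>?M i j\<bar>) \<le> 2 * ?M i i" .
  qed (use entry_sym in auto)
  also have "(\<Sum>i<n. \<Sum>j<n. cnj (x i) * of_real (?M i j) * x j) =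
     3/2 * (\<Sum>i<n. \<Sum>j<n. cnj (x i) * of_real (tau_entry i j) * x j)
     - (\<Sum>i<n. \<Sum>j<n. cnj (x i) * of_real (toeplitz_entry t n i j) * x j)"
    unfolding sum_distrib_left sum_subtractf[symmetric] by (intro sum.cong refl) (simp add: algebra_simps)
  finally show ?thesis by simp
qed

end

lemma tau_dominance_sym_coeff:
  assumes "0 < d" "d < 1" "0 \<le> c"
  shows "tau_dominance (\<lambda>k. c * sym_coeff d k) n"
proof
  fix k l :: nat
  show "c * sym_coeff d k \<le> 0" if "1 \<le> k"
    using sym_coeff_nonpos[OF assms(1,2) that] assms(3) by (simp add: mult_nonneg_nonpos)
  show "c * sym_coeff d k \<le> c * sym_coeff d l" if "1 \<le> k" "k \<le> l"
    using sym_coeff_mono[OF assms(1,2) that] assms(3) by (rule mult_left_mono)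
  have "0 \<le> c * (sym_coeff d 0 + 2 * (\<Sum>k = 1..n - 1. sym_coeff d k))"
    using sym_coeff_partial_sum_nonneg[OF assms(1,2)] assms(3) by simp
  then show "0 \<le> c * sym_coeff d 0 + 2 * (\<Sum>k = 1..n - 1. c * sym_coeff d k)"
    by (simp add: distrib_left sum_distrib_left mult_ac)
qed

section \<open>The one-dimensional bound for B_n\<close>

lemma T_mat_carrier [simp]: "T_mat d n \<in> carrier_mat n n"
  by (simp add: T_mat_def)

lemma T_mat_dim [simp]: "dim_row (T_mat d n) = n" "dim_col (T_mat d n) = n"
  by (simp_all add: T_mat_def)

lemma T_mat_entry:
  assumes "i < n" "j < n"
  shows "T_mat d n $$ (i, j) = toep_coeff d (int i - int j)"
proof -
  have "nat (int i - int j + 1) = i + 1 - j" by arith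
  then show ?thesis using assms by (auto simp: T_mat_def toep_coeff_def)
qed

lemma B_mat_carrier [simp]: "B_mat kp km d n \<in> carrier_mat n n"
  by (simp add: B_mat_def)

lemma sym_part_carrier [simp]: "X \<in> carrier_mat n n \<Longrightarrow> sym_part X \<in> carrier_mat n n"
  and skew_part_carrier [simp]: "X \<in> carrier_mat n n \<Longrightarrow> skew_part X \<in> carrier_mat n n"
  by (auto simp: sym_part_def skew_part_def)

text \<open>T_n and its transpose have the same symmetric part, so only the sum of the two constants
  survives.\<close>

lemma sym_part_B_mat_entry:
  assumes "i < n" "j < n"
  shows "sym_part (B_mat kp km d n) $$ (i, j) = toeplitz_entry (\<lambda>k. (kp + km) * sym_coeff d k) n i j"
proof -
  have "sym_part (B_mat kp km d n) $$ (i, j) = (kp + km) * ((T_mat d n $$ (i, j) + T_mat d n $$ (j, i)) / 2)"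
    using assms T_mat_carrier[of d n] by (simp add: sym_part_def B_mat_def field_simps)
  then show ?thesis
    using assms by (simp add: T_mat_entry toeplitz_entry_conv sym_coeff_def of_nat_diff add.commute)
qed

lemma tau_mat_sym_part_B_mat:
  fixes kp km d :: real
  assumes "0 < n"
  defines "t \<equiv> \<lambda>k. (kp + km) * sym_coeff d k"
  shows "tau_mat (sym_part (B_mat kp km d n)) = sine_mat n * mat_diag n (\<lambda>k. t 0 + 2 * (\<Sum>m = 1..n - 1.
      t m * cos (real m * real (k + 1) * pi / (real n + 1)))) * sine_mat n"
proof -
  have "sym_part (B_mat kp km d n) $$ (m, 0) = t m" if "m < n" for m
    using that assms by (simp add: sym_part_B_mat_entry toeplitz_entry_conv)
  then have "mat_diag n (\<lambda>k. sym_part (B_mat kp km d n) $$ (0, 0) + 2 * (\<Sum>m = 1..n - 1.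
      sym_part (B_mat kp km d n) $$ (m, 0) * cos (real m * real (k + 1) * pi / (real n + 1)))) =
    mat_diag n (\<lambda>k. t 0 + 2 * (\<Sum>m = 1..n - 1. t m * cos (real m * real (k + 1) * pi / (real n + 1))))"
    using assms(1) by (intro arg_cong[of _ _ "mat_diag n"] ext arg_cong2[of _ _ _ _ "(+)"] arg_cong[of _ _ "(*) 2"] sum.cong) auto
  moreover have "dim_row (sym_part (B_mat kp km d n)) = n"
    using sym_part_carrier[OF B_mat_carrier] by blast
  ultimately show ?thesis by (simp add: tau_mat_def Let_def)
qed

lemma tau_mat_sym_part_B_mat_entry:
  assumes "i < n" "j < n"
  shows "tau_mat (sym_part (B_mat kp km d n)) $$ (i, j) =
    toeplitz_entry (\<lambda>k. (kp + km) * sym_coeff d k) n i j - hankel_entry (\<lambda>k. (kp + km) * sym_coeff d k) n i j"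
proof -
  have "0 < n" using assms by simp
  then show ?thesis
    unfolding tau_mat_sym_part_B_mat[OF \<open>0 < n\<close>] by (intro sine_diag_sine_entry assms)
qed

lemma tau_mat_sym_part_B_mat_carrier [simp]:
  "tau_mat (sym_part (B_mat kp km d n)) \<in> carrier_mat n n"
proof -
  have "dim_row (sym_part (B_mat kp km d n)) = n"
    using sym_part_carrier[OF B_mat_carrier] by blast
  then show ?thesis
    unfolding tau_mat_def Let_def by (simp only:) (intro mult_carrier_mat[of _ n n _ n] sine_mat_carrier mat_diag_dim)
qed

definition form_nonneg :: "real mat \<Rightarrow> bool" where
  "form_nonneg R \<longleftrightarrow> (\<forall>x. 0 \<le> Re (qform R x))"

text \<open>Stated for Z rather than its skew part: the imaginary part of the form sees only the
  skew part anyway, and no transposes enter the calculations with Kronecker products.\<close>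

definition form_bounded :: "real \<Rightarrow> real mat \<Rightarrow> real mat \<Rightarrow> bool" where
  "form_bounded c Z R \<longleftrightarrow> (\<forall>x. \<bar>Im (qform Z x)\<bar> \<le> c * Re (qform R x))"

lemma qform_carrier:
  "Z \<in> carrier_mat n n \<Longrightarrow> qform Z x = (\<Sum>i<n. \<Sum>j<n. cnj (x i) * of_real (Z $$ (i, j)) * x j)"
  by (auto simp: qform_def)

lemma qform_sym_part_B_mat:
  "qform (sym_part (B_mat kp km d n)) x =
    (\<Sum>i<n. \<Sum>j<n. cnj (x i) * of_real (toeplitz_entry (\<lambda>k. (kp + km) * sym_coeff d k) n i j) * x j)"
  unfolding qform_carrier[OF sym_part_carrier[OF B_mat_carrier]]
  by (intro sum.cong refl) (simp add: sym_part_B_mat_entry)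

lemma qform_tau_mat_sym_part_B_mat:
  "qform (tau_mat (sym_part (B_mat kp km d n))) x =
    (\<Sum>i<n. \<Sum>j<n. cnj (x i) * of_real (toeplitz_entry (\<lambda>k. (kp + km) * sym_coeff d k) n i j
      - hankel_entry (\<lambda>k. (kp + km) * sym_coeff d k) n i j) * x j)"
  unfolding qform_carrier[OF tau_mat_sym_part_B_mat_carrier]
  by (intro sum.cong refl) (simp add: tau_mat_sym_part_B_mat_entry)

lemma form_nonneg_tau_B_mat:
  assumes "0 < d" "d < 1" "0 \<le> kp + km"
  shows "form_nonneg (tau_mat (sym_part (B_mat kp km d n)))"
proof -
  interpret tau_dominance "\<lambda>k. (kp + km) * sym_coeff d k" n
    by (rule tau_dominance_sym_coeff[OF assms])
  show ?thesis
    unfolding form_nonneg_def qform_tau_mat_sym_part_B_mat using tau_form_nonneg by blast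
qed

text \<open>If Q is the form of T_n, its transpose has the form cnj Q. The imaginary part thus
  carries kp - km and the real part kp + km, which is where the quotient comes from.\<close>

lemma form_bounded_B_mat:
  assumes d: "0 < d" "d < 1" and k: "0 < kp" "0 < km"
  shows "form_bounded (3/2 * (tan (d / 2 * pi) * (\<bar>kp - km\<bar> / (kp + km))))
    (B_mat kp km d n) (tau_mat (sym_part (B_mat kp km d n)))"
  unfolding form_bounded_def
proof
  fix x
  interpret tau_dominance "\<lambda>k. (kp + km) * sym_coeff d k" n
    by (rule tau_dominance_sym_coeff) (use assms in auto)
  define Q where "Q = toep_form (\<lambda>m. of_real (toep_coeff d m)) n x"
  have Q: "Q = (\<Sum>i<n. \<Sum>j<n. cnj (x i) * of_real (T_mat d n $$ (i, j)) * x j)"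
    unfolding Q_def toep_form_def by (intro sum.cong refl) (simp add: T_mat_entry mult_ac)
  have Q': "cnj Q = (\<Sum>i<n. \<Sum>j<n. cnj (x i) * of_real (T_mat d n $$ (j, i)) * x j)"
    unfolding Q cnj_sum by (subst sum.swap) (intro sum.cong refl, simp add: mult_ac)
  have "qform (B_mat kp km d n) x = of_real kp * Q + of_real km * cnj Q"
    unfolding qform_carrier[OF B_mat_carrier] Q' unfolding Q
    unfolding sum.distrib[symmetric] sum_distrib_left
    by (intro sum.cong refl) (simp add: B_mat_def algebra_simps)
  then have "Im (qform (B_mat kp km d n) x) = (kp - km) * Im Q"
    by (simp add: algebra_simps)
  then have 1: "\<bar>Im (qform (B_mat kp km d n) x)\<bar> = \<bar>kp - km\<bar> * \<bar>Im Q\<bar>"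
    by (simp add: abs_mult)
  have "qform (sym_part (B_mat kp km d n)) x = of_real ((kp + km) / 2) * (Q + cnj Q)"
    unfolding qform_carrier[OF sym_part_carrier[OF B_mat_carrier]] Q' unfolding Q
    unfolding sum.distrib[symmetric] sum_distrib_left
    by (intro sum.cong refl)
      (use T_mat_carrier[of d n] in \<open>simp add: sym_part_def B_mat_def field_simps\<close>)
  then have 2: "Re (qform (sym_part (B_mat kp km d n)) x) = (kp + km) * Re Q"
    by (simp only:) (simp add: field_simps)
  have 3: "Re (qform (sym_part (B_mat kp km d n)) x) \<le> 3/2 * Re (qform (tau_mat (sym_part (B_mat kp km d n))) x)"
    unfolding qform_sym_part_B_mat qform_tau_mat_sym_part_B_mat by (rule toeplitz_form_le_tau_form)
  define T where "T = tan (d / 2 * pi)"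
  have T: "0 \<le> T" unfolding T_def using d by (intro less_imp_le tan_gt_zero) (auto simp: field_simps)
  have "\<bar>Im (qform (B_mat kp km d n) x)\<bar> \<le> \<bar>kp - km\<bar> * (T * Re Q)"
    unfolding 1 T_def using toep_coeff_form_sector[OF d, of n x]
    by (intro mult_left_mono) (simp_all add: Q_def mult.commute)
  also have "\<dots> = T * (\<bar>kp - km\<bar> / (kp + km)) * Re (qform (sym_part (B_mat kp km d n)) x)"
    unfolding 2 using k by simp
  also have "\<dots> \<le> T * (\<bar>kp - km\<bar> / (kp + km)) * (3/2 * Re (qform (tau_mat (sym_part (B_mat kp km d n))) x))"
    using 3 T k by (intro mult_left_mono) auto
  finally show "\<bar>Im (qform (B_mat kp km d n) x)\<bar> \<le>
      3/2 * (tan (d / 2 * pi) * (\<bar>kp - km\<bar> / (kp + km))) * Re (qform (tau_mat (sym_part (B_mat kp km d n))) x)"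
    by (simp add: T_def mult_ac)
qed

section \<open>Kronecker products\<close>

lemma mult_add_less_mult:
  assumes "i < m" "j < (n::nat)"
  shows "i * n + j < m * n"
proof -
  have "i * n + j < Suc i * n" using assms by simp
  also have "\<dots> \<le> m * n" using assms by (intro mult_le_mono) auto
  finally show ?thesis .
qed

lemma div_mod_less:
  assumes "(a::nat) < m * n"
  shows "a div n < m" "a mod n < n"
proof -
  show "a div n < m" using assms by (rule less_mult_imp_div_less)
  have "n > 0" using assms by (cases n) auto
  then show "a mod n < n" by simp
qed

lemma sum_div_mod:
  fixes f :: "nat \<Rightarrow> nat \<Rightarrow> 'a :: comm_monoid_add"
  shows "(\<Sum>a<m * n. f (a div n) (a mod n)) = (\<Sum>i<m. \<Sum>j<n. f i j)"
proof -
  have "(\<Sum>i<m. \<Sum>j<n. f i j) = (\<Sum>(i, j)\<in>{..<m} \<times> {..<n}. f i j)"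
    by (rule sum.cartesian_product)
  also have "\<dots> = (\<Sum>a<m * n. f (a div n) (a mod n))"
    by (rule sum.reindex_bij_witness[of _ "\<lambda>a. (a div n, a mod n)" "\<lambda>(i, j). i * n + j"])
      (auto simp: div_mod_less mult_add_less_mult)
  finally show ?thesis by simp
qed

lemma kron_carrier [simp]:
  "A \<in> carrier_mat m p \<Longrightarrow> B \<in> carrier_mat n q \<Longrightarrow> A \<otimes>\<^sub>K B \<in> carrier_mat (m * n) (p * q)"
  by (auto simp: kron_def)

lemma kron_entry:
  assumes "A \<in> carrier_mat m p" "B \<in> carrier_mat n q" "i < m * n" "j < p * q"
  shows "(A \<otimes>\<^sub>K B) $$ (i, j) = A $$ (i div n, j div q) * B $$ (i mod n, j mod q)"
  using assms by (auto simp: kron_def)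

lemma kron_mult:
  assumes "A \<in> carrier_mat m m" "B \<in> carrier_mat n n" "C \<in> carrier_mat m m" "D \<in> carrier_mat n n"
  shows "(A \<otimes>\<^sub>K B) * (C \<otimes>\<^sub>K D) = (A * C) \<otimes>\<^sub>K (B * D)"
proof (rule eq_matI)
  have AC: "A * C \<in> carrier_mat m m" and BD: "B * D \<in> carrier_mat n n"
    using assms by auto
  show "dim_row ((A \<otimes>\<^sub>K B) * (C \<otimes>\<^sub>K D)) = dim_row ((A * C) \<otimes>\<^sub>K (B * D))"
    "dim_col ((A \<otimes>\<^sub>K B) * (C \<otimes>\<^sub>K D)) = dim_col ((A * C) \<otimes>\<^sub>K (B * D))"
    using assms by (auto simp: kron_def)
  fix i j assume "i < dim_row ((A * C) \<otimes>\<^sub>K (B * D))" "j < dim_col ((A * C) \<otimes>\<^sub>K (B * D))"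
  then have ij: "i < m * n" "j < m * n" using kron_carrier[OF AC BD] by auto
  note d = div_mod_less[OF ij(1)] div_mod_less[OF ij(2)]
  have "((A \<otimes>\<^sub>K B) * (C \<otimes>\<^sub>K D)) $$ (i, j) = (\<Sum>a<m * n. (A \<otimes>\<^sub>K B) $$ (i, a) * (C \<otimes>\<^sub>K D) $$ (a, j))"
    using assms ij by (intro mult_mat_entry) auto
  also have "\<dots> = (\<Sum>a<m * n. (A $$ (i div n, a div n) * C $$ (a div n, j div n)) * (B $$ (i mod n, a mod n) * D $$ (a mod n, j mod n)))"
    using ij by (intro sum.cong refl) (simp add: kron_entry[OF assms(1,2)] kron_entry[OF assms(3,4)])
  also have "\<dots> = (\<Sum>k<m. \<Sum>l<n. (A $$ (i div n, k) * C $$ (k, j div n)) * (B $$ (i mod n, l) * D $$ (l, j mod n)))"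
    by (rule sum_div_mod)
  also have "\<dots> = (A * C) $$ (i div n, j div n) * (B * D) $$ (i mod n, j mod n)"
    unfolding mult_mat_entry[OF assms(1,3) d(1,3)] mult_mat_entry[OF assms(2,4) d(2,4)] sum_product ..
  also have "\<dots> = ((A * C) \<otimes>\<^sub>K (B * D)) $$ (i, j)"
    using kron_entry[OF AC BD ij] by simp
  finally show "((A \<otimes>\<^sub>K B) * (C \<otimes>\<^sub>K D)) $$ (i, j) = ((A * C) \<otimes>\<^sub>K (B * D)) $$ (i, j)" .
qed

lemma transpose_kron: "transpose_mat (A \<otimes>\<^sub>K B) = transpose_mat A \<otimes>\<^sub>K transpose_mat B"
  by (rule eq_matI) (auto simp: kron_def div_mod_less less_mult_imp_div_less)

lemma kron_mat_diag:
  "mat_diag m d \<otimes>\<^sub>K mat_diag n e = mat_diag (m * n) (\<lambda>i. d (i div n) * e (i mod n))"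
proof (rule eq_matI)
  fix i j assume "i < dim_row (mat_diag (m * n) (\<lambda>i. d (i div n) * e (i mod n)))"
    "j < dim_col (mat_diag (m * n) (\<lambda>i. d (i div n) * e (i mod n)))"
  then have ij: "i < m * n" "j < m * n" by (auto simp: mat_diag_def)
  have eq: "i = j" if "i div n = j div n" "i mod n = j mod n"
    using that by (metis div_mult_mod_eq)
  show "(mat_diag m d \<otimes>\<^sub>K mat_diag n e) $$ (i, j) = mat_diag (m * n) (\<lambda>i. d (i div n) * e (i mod n)) $$ (i, j)"
    using ij div_mod_less[OF ij(1)] div_mod_less[OF ij(2)] eq
    by (auto simp: kron_entry[of _ m m _ n n] mat_diag_def)
qed (auto simp: kron_def mat_diag_def)

lemma one_kron_one: "1\<^sub>m m \<otimes>\<^sub>K 1\<^sub>m n = 1\<^sub>m (m * n)"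
  using kron_mat_diag[of m "\<lambda>_. 1" n "\<lambda>_. 1"] by simp

section \<open>Matrices diagonalised by a symmetric involution\<close>

text \<open>The sine matrix is its own transpose and its own inverse. Kronecker products inherit
  this, so a single U diagonalises all of P.\<close>

definition sym_invol :: "nat \<Rightarrow> real mat \<Rightarrow> bool" where
  "sym_invol n U \<longleftrightarrow> U \<in> carrier_mat n n \<and> transpose_mat U = U \<and> U * U = 1\<^sub>m n"

definition diag_by :: "nat \<Rightarrow> real mat \<Rightarrow> (nat \<Rightarrow> real) \<Rightarrow> real mat" where
  "diag_by n U d = U * mat_diag n d * U"

lemma diag_by_carrier [simp]: "U \<in> carrier_mat n n \<Longrightarrow> diag_by n U d \<in> carrier_mat n n"
  unfolding diag_by_def by (intro mult_carrier_mat[of _ n n _ n] mat_diag_dim)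

lemma sym_invol_sine_mat: "sym_invol n (sine_mat n)"
  by (simp add: sym_invol_def transpose_sine_mat sine_mat_involution)

lemma sym_invol_kron: "sym_invol m U \<Longrightarrow> sym_invol n V \<Longrightarrow> sym_invol (m * n) (U \<otimes>\<^sub>K V)"
  by (auto simp: sym_invol_def transpose_kron kron_mult[of _ m _ n] one_kron_one)

lemma diag_by_kron:
  assumes "U \<in> carrier_mat m m" "V \<in> carrier_mat n n"
  shows "diag_by m U d \<otimes>\<^sub>K diag_by n V e = diag_by (m * n) (U \<otimes>\<^sub>K V) (\<lambda>i. d (i div n) * e (i mod n))"
  unfolding diag_by_def kron_mat_diag[symmetric]
  using assms by (simp add: kron_mult[of _ m _ n])

lemma diag_by_entry:
  assumes "sym_invol n U" "i < n" "j < n"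
  shows "diag_by n U d $$ (i, j) = (\<Sum>k<n. d k * U $$ (k, i) * U $$ (k, j))"
proof -
  have U: "U \<in> carrier_mat n n" and T: "transpose_mat U = U" using assms by (auto simp: sym_invol_def)
  have s: "U $$ (i, k) = U $$ (k, i)" if "k < n" for k
    using that U assms(2) T by (metis carrier_matD index_transpose_mat(1))
  have "diag_by n U d $$ (i, j) = (\<Sum>k<n. (U * mat_diag n d) $$ (i, k) * U $$ (k, j))"
    unfolding diag_by_def using U assms by (intro mult_mat_entry[of _ n n _ n]) auto
  also have "\<dots> = (\<Sum>k<n. d k * U $$ (k, i) * U $$ (k, j))"
    using U assms s by (intro sum.cong refl) (simp add: mat_diag_mult_right)
  finally show ?thesis .
qed

lemma diag_by_add:
  assumes "U \<in> carrier_mat n n"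
  shows "diag_by n U d + diag_by n U e = diag_by n U (\<lambda>k. d k + e k)"
proof -
  have "mat_diag n (\<lambda>k. d k + e k) = mat_diag n d + mat_diag n e"
    by (rule eq_matI) (auto simp: mat_diag_def)
  then show ?thesis
    unfolding diag_by_def using assms
    by (simp add: mult_add_distrib_mat[of _ n n _ n] add_mult_distrib_mat[of _ n n _ _ n])
qed

lemma diag_by_smult:
  assumes "U \<in> carrier_mat n n"
  shows "c \<cdot>\<^sub>m diag_by n U d = diag_by n U (\<lambda>k. c * d k)"
proof -
  have "mat_diag n (\<lambda>k. c * d k) = c \<cdot>\<^sub>m mat_diag n d"
    by (rule eq_matI) (auto simp: mat_diag_def)
  then show ?thesis
    unfolding diag_by_def using assms
    by (simp add: mult_smult_distrib[of _ n n _ n] mult_smult_assoc_mat[of _ n n _ n])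
qed

lemma diag_by_mult:
  assumes "sym_invol n U"
  shows "diag_by n U d * diag_by n U e = diag_by n U (\<lambda>k. d k * e k)"
proof -
  have U: "U \<in> carrier_mat n n" and UU: "U * U = 1\<^sub>m n" using assms by (auto simp: sym_invol_def)
  have cancel: "U * (U * W) = W" if "W \<in> carrier_mat n n" for W
    using assoc_mult_mat[OF U U that] that UU by simp
  have c: "X * Y \<in> carrier_mat n n" if "X \<in> carrier_mat n n" "Y \<in> carrier_mat n n" for X Y :: "real mat"
    using that by (rule mult_carrier_mat)
  note a = assoc_mult_mat[of _ n n _ n _ n]
  have "mat_diag n d * (mat_diag n e * U) = mat_diag n (\<lambda>k. d k * e k) * U"
    by (subst a[symmetric]) (auto simp: U)
  then show ?thesis
    unfolding diag_by_def by (simp add: a c U cancel)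
qed

lemma diag_by_one: "sym_invol n U \<Longrightarrow> diag_by n U (\<lambda>_. 1) = 1\<^sub>m n"
  by (auto simp: diag_by_def sym_invol_def)

lemma transpose_diag_by:
  assumes "sym_invol n U" shows "transpose_mat (diag_by n U d) = diag_by n U d"
proof (rule eq_matI)
  have U: "U \<in> carrier_mat n n" using assms by (simp add: sym_invol_def)
  show "dim_row (transpose_mat (diag_by n U d)) = dim_row (diag_by n U d)"
    "dim_col (transpose_mat (diag_by n U d)) = dim_col (diag_by n U d)"
    using diag_by_carrier[OF U, of d] by auto
  fix i j assume "i < dim_row (diag_by n U d)" "j < dim_col (diag_by n U d)"
  then have "i < n" "j < n" using diag_by_carrier[OF U, of d] by auto
  then show "transpose_mat (diag_by n U d) $$ (i, j) = diag_by n U d $$ (i, j)"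
    using diag_by_carrier[OF U, of d] by (simp add: diag_by_entry[OF assms] mult_ac)
qed

text \<open>Generic in the scalars: complex vectors occur in \<open>qform\<close>, real ones in the
  proof of positive definiteness.\<close>

lemma gram_sum:
  fixes a b :: "nat \<Rightarrow> 'a :: {real_algebra_1, comm_ring_1}"
  assumes "sym_invol m U"
  shows "(\<Sum>k<m. of_real (d k) * (\<Sum>i<m. of_real (U $$ (k, i)) * a i) * (\<Sum>j<m. of_real (U $$ (k, j)) * b j)) =
    (\<Sum>i<m. \<Sum>j<m. of_real (diag_by m U d $$ (i, j)) * (a i * b j))"
proof -
  have "(\<Sum>k<m. of_real (d k) * (\<Sum>i<m. of_real (U $$ (k, i)) * a i) * (\<Sum>j<m. of_real (U $$ (k, j)) * b j)) =
    (\<Sum>k<m. \<Sum>i<m. \<Sum>j<m. of_real (d k * U $$ (k, i) * U $$ (k, j)) * (a i * b j))"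
    unfolding mult.assoc sum_product unfolding sum_distrib_left by (intro sum.cong refl) (simp add: mult_ac)
  also have "\<dots> = (\<Sum>i<m. \<Sum>k<m. \<Sum>j<m. of_real (d k * U $$ (k, i) * U $$ (k, j)) * (a i * b j))"
    by (rule sum.swap)
  also have "\<dots> = (\<Sum>i<m. \<Sum>j<m. \<Sum>k<m. of_real (d k * U $$ (k, i) * U $$ (k, j)) * (a i * b j))"
    by (intro sum.cong refl sum.swap)
  also have "\<dots> = (\<Sum>i<m. \<Sum>j<m. of_real (diag_by m U d $$ (i, j)) * (a i * b j))"
    by (intro sum.cong refl) (simp add: diag_by_entry[OF assms] sum_distrib_right)
  finally show ?thesis .
qed

lemma qform_kron:
  assumes "A \<in> carrier_mat m m" "Z \<in> carrier_mat n n"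
  shows "qform (A \<otimes>\<^sub>K Z) x = (\<Sum>i<m. \<Sum>j<n. \<Sum>i'<m. \<Sum>j'<n.
    cnj (x (i * n + j)) * of_real (A $$ (i, i') * Z $$ (j, j')) * x (i' * n + j'))"
proof -
  have "qform (A \<otimes>\<^sub>K Z) x = (\<Sum>a<m * n. \<Sum>b<m * n. cnj (x (a div n * n + a mod n)) *
      of_real (A $$ (a div n, b div n) * Z $$ (a mod n, b mod n)) * x (b div n * n + b mod n))"
    unfolding qform_carrier[OF kron_carrier[OF assms]]
    by (intro sum.cong refl) (simp add: kron_entry[OF assms])
  also have "\<dots> = (\<Sum>a<m * n. \<Sum>i'<m. \<Sum>j'<n. cnj (x (a div n * n + a mod n)) *
      of_real (A $$ (a div n, i') * Z $$ (a mod n, j')) * x (i' * n + j'))"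
    by (intro sum.cong refl sum_div_mod)
  also have "\<dots> = (\<Sum>i<m. \<Sum>j<n. \<Sum>i'<m. \<Sum>j'<n.
    cnj (x (i * n + j)) * of_real (A $$ (i, i') * Z $$ (j, j')) * x (i' * n + j'))"
    by (rule sum_div_mod)
  finally show ?thesis .
qed

text \<open>Diagonalising one factor splits the form into forms of the other factor at transformed
  slices of x, weighted by eigenvalues. Z stays general so that the nonsymmetric B_n fits.\<close>

lemma qform_diag_by_kron:
  assumes U: "sym_invol m U" and Z: "Z \<in> carrier_mat n n"
  shows "qform (diag_by m U d \<otimes>\<^sub>K Z) x =
    (\<Sum>k<m. of_real (d k) * qform Z (\<lambda>j. \<Sum>i<m. of_real (U $$ (k, i)) * x (i * n + j)))"
proof -
  let ?A = "diag_by m U d"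
  let ?y = "\<lambda>k j. \<Sum>i<m. of_real (U $$ (k, i)) * x (i * n + j)"
  have A: "?A \<in> carrier_mat m m" using U by (simp add: sym_invol_def)
  have "(\<Sum>k<m. of_real (d k) * qform Z (?y k)) =
     (\<Sum>k<m. \<Sum>j<n. \<Sum>j'<n. of_real (Z $$ (j, j')) * (of_real (d k) * cnj (?y k j) * ?y k j'))"
    unfolding qform_carrier[OF Z] sum_distrib_left[of "of_real _" _ "{..<n}"]
    by (intro sum.cong refl) (simp only: mult_ac)
  also have "\<dots> = (\<Sum>j<n. \<Sum>k<m. \<Sum>j'<n. of_real (Z $$ (j, j')) * (of_real (d k) * cnj (?y k j) * ?y k j'))"
    by (rule sum.swap)
  also have "\<dots> = (\<Sum>j<n. \<Sum>j'<n. \<Sum>k<m. of_real (Z $$ (j, j')) * (of_real (d k) * cnj (?y k j) * ?y k j'))"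
    by (intro sum.cong refl sum.swap)
  also have "\<dots> = (\<Sum>j<n. \<Sum>j'<n. of_real (Z $$ (j, j')) * (\<Sum>i<m. \<Sum>i'<m. of_real (?A $$ (i, i')) * (cnj (x (i * n + j)) * x (i' * n + j'))))"
  proof (intro sum.cong refl)
    fix j j'
    show "(\<Sum>k<m. of_real (Z $$ (j, j')) * (of_real (d k) * cnj (?y k j) * ?y k j')) =
      of_real (Z $$ (j, j')) * (\<Sum>i<m. \<Sum>i'<m. of_real (?A $$ (i, i')) * (cnj (x (i * n + j)) * x (i' * n + j')))"
      unfolding gram_sum[OF U, symmetric] sum_distrib_left[of "of_real _" _ "{..<m}", symmetric] cnj_sum
      by (simp only: complex_cnj_mult complex_cnj_complex_of_real)
  qed
  also have "\<dots> = (\<Sum>j<n. \<Sum>j'<n. \<Sum>i<m. \<Sum>i'<m. cnj (x (i * n + j)) * of_real (?A $$ (i, i') * Z $$ (j, j')) * x (i' * n + j'))"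
    unfolding sum_distrib_left by (intro sum.cong refl) (simp add: mult_ac)
  also have "\<dots> = (\<Sum>j<n. \<Sum>i<m. \<Sum>j'<n. \<Sum>i'<m. cnj (x (i * n + j)) * of_real (?A $$ (i, i') * Z $$ (j, j')) * x (i' * n + j'))"
    by (intro sum.cong refl sum.swap)
  also have "\<dots> = (\<Sum>i<m. \<Sum>j<n. \<Sum>j'<n. \<Sum>i'<m. cnj (x (i * n + j)) * of_real (?A $$ (i, i') * Z $$ (j, j')) * x (i' * n + j'))"
    by (rule sum.swap)
  also have "\<dots> = (\<Sum>i<m. \<Sum>j<n. \<Sum>i'<m. \<Sum>j'<n. cnj (x (i * n + j)) * of_real (?A $$ (i, i') * Z $$ (j, j')) * x (i' * n + j'))"
    by (intro sum.cong refl sum.swap)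
  also have "\<dots> = qform (?A \<otimes>\<^sub>K Z) x"
    by (rule qform_kron[OF A Z, symmetric])
  finally show ?thesis by simp
qed

lemma qform_kron_diag_by:
  assumes U: "sym_invol m U" and Z: "Z \<in> carrier_mat n n"
  shows "qform (Z \<otimes>\<^sub>K diag_by m U d) x =
    (\<Sum>k<m. of_real (d k) * qform Z (\<lambda>i. \<Sum>j<m. of_real (U $$ (k, j)) * x (i * m + j)))"
proof -
  let ?A = "diag_by m U d"
  let ?y = "\<lambda>k i. \<Sum>j<m. of_real (U $$ (k, j)) * x (i * m + j)"
  have A: "?A \<in> carrier_mat m m" using U by (simp add: sym_invol_def)
  have "(\<Sum>k<m. of_real (d k) * qform Z (?y k)) =
     (\<Sum>k<m. \<Sum>i<n. \<Sum>i'<n. of_real (Z $$ (i, i')) * (of_real (d k) * cnj (?y k i) * ?y k i'))"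
    unfolding qform_carrier[OF Z] sum_distrib_left[of "of_real _" _ "{..<n}"]
    by (intro sum.cong refl) (simp only: mult_ac)
  also have "\<dots> = (\<Sum>i<n. \<Sum>k<m. \<Sum>i'<n. of_real (Z $$ (i, i')) * (of_real (d k) * cnj (?y k i) * ?y k i'))"
    by (rule sum.swap)
  also have "\<dots> = (\<Sum>i<n. \<Sum>i'<n. \<Sum>k<m. of_real (Z $$ (i, i')) * (of_real (d k) * cnj (?y k i) * ?y k i'))"
    by (intro sum.cong refl sum.swap)
  also have "\<dots> = (\<Sum>i<n. \<Sum>i'<n. of_real (Z $$ (i, i')) * (\<Sum>j<m. \<Sum>j'<m. of_real (?A $$ (j, j')) * (cnj (x (i * m + j)) * x (i' * m + j'))))"
  proof (intro sum.cong refl)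
    fix i i'
    show "(\<Sum>k<m. of_real (Z $$ (i, i')) * (of_real (d k) * cnj (?y k i) * ?y k i')) =
      of_real (Z $$ (i, i')) * (\<Sum>j<m. \<Sum>j'<m. of_real (?A $$ (j, j')) * (cnj (x (i * m + j)) * x (i' * m + j')))"
      unfolding gram_sum[OF U, symmetric] sum_distrib_left[of "of_real _" _ "{..<m}", symmetric] cnj_sum
      by (simp only: complex_cnj_mult complex_cnj_complex_of_real)
  qed
  also have "\<dots> = (\<Sum>i<n. \<Sum>i'<n. \<Sum>j<m. \<Sum>j'<m. cnj (x (i * m + j)) * of_real (Z $$ (i, i') * ?A $$ (j, j')) * x (i' * m + j'))"
    unfolding sum_distrib_left by (intro sum.cong refl) (simp add: mult_ac)
  also have "\<dots> = (\<Sum>i<n. \<Sum>j<m. \<Sum>i'<n. \<Sum>j'<m. cnj (x (i * m + j)) * of_real (Z $$ (i, i') * ?A $$ (j, j')) * x (i' * m + j'))"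
    by (intro sum.cong refl sum.swap)
  also have "\<dots> = qform (Z \<otimes>\<^sub>K ?A) x"
    by (rule qform_kron[OF Z A, symmetric])
  finally show ?thesis by simp
qed

lemma abs_Im_weighted_sum_le:
  fixes f g :: "nat \<Rightarrow> complex"
  assumes "\<And>k. k < m \<Longrightarrow> 0 \<le> d k" "\<And>k. \<bar>Im (f k)\<bar> \<le> c * Re (g k)"
  shows "\<bar>Im (\<Sum>k<m. of_real (d k) * f k)\<bar> \<le> c * Re (\<Sum>k<m. of_real (d k) * g k)"
proof -
  have "\<bar>Im (\<Sum>k<m. of_real (d k) * f k)\<bar> \<le> (\<Sum>k<m. \<bar>Im (of_real (d k) * f k)\<bar>)"
    unfolding Im_sum by (rule sum_abs)
  also have "\<dots> \<le> (\<Sum>k<m. d k * (c * Re (g k)))"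
    using assms by (intro sum_mono) (auto simp: abs_mult intro!: mult_left_mono)
  also have "\<dots> = c * Re (\<Sum>k<m. of_real (d k) * g k)"
    by (simp add: sum_distrib_left mult_ac)
  finally show ?thesis .
qed

text \<open>A bound on |Im| by Re is preserved by sums with nonnegative weights. Both orders are
  needed because B_n takes each of the three positions.\<close>

lemma form_bounded_kron:
  assumes U: "sym_invol m U" and d: "\<And>k. k < m \<Longrightarrow> 0 \<le> d k"
    and "Z \<in> carrier_mat n n" "R \<in> carrier_mat n n" "form_bounded c Z R"
  shows "form_bounded c (diag_by m U d \<otimes>\<^sub>K Z) (diag_by m U d \<otimes>\<^sub>K R)"
    and "form_bounded c (Z \<otimes>\<^sub>K diag_by m U d) (R \<otimes>\<^sub>K diag_by m U d)"
proof -
  show "form_bounded c (diag_by m U d \<otimes>\<^sub>K Z) (diag_by m U d \<otimes>\<^sub>K R)"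
    unfolding form_bounded_def qform_diag_by_kron[OF U assms(3)] qform_diag_by_kron[OF U assms(4)]
    using assms(5) by (intro allI abs_Im_weighted_sum_le d) (auto simp: form_bounded_def)
  show "form_bounded c (Z \<otimes>\<^sub>K diag_by m U d) (R \<otimes>\<^sub>K diag_by m U d)"
    unfolding form_bounded_def qform_kron_diag_by[OF U assms(3)] qform_kron_diag_by[OF U assms(4)]
    using assms(5) by (intro allI abs_Im_weighted_sum_le d) (auto simp: form_bounded_def)
qed

section \<open>Square roots and the spectral radius\<close>

lemma qform_add:
  assumes "X \<in> carrier_mat n n" "Y \<in> carrier_mat n n"
  shows "qform (X + Y) x = qform X x + qform Y x"
proof -
  have XY: "X + Y \<in> carrier_mat n n" using assms by simp
  show ?thesis
    unfolding qform_carrier[OF assms(1)] qform_carrier[OF assms(2)] qform_carrier[OF XY] sum.distrib[symmetric]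
    using assms by (intro sum.cong refl) (simp add: algebra_simps)
qed

lemma qform_smult:
  assumes "X \<in> carrier_mat n n"
  shows "qform (c \<cdot>\<^sub>m X) x = of_real c * qform X x"
proof -
  have cX: "c \<cdot>\<^sub>m X \<in> carrier_mat n n" using assms by simp
  show ?thesis
    unfolding qform_carrier[OF assms(1)] qform_carrier[OF cX] sum_distrib_left
    using assms by (intro sum.cong refl) (simp add: algebra_simps)
qed

lemma qform_transpose:
  assumes "X \<in> carrier_mat n n"
  shows "qform (transpose_mat X) x = cnj (qform X x)"
proof -
  have tX: "transpose_mat X \<in> carrier_mat n n" using assms by simp
  show ?thesis
    unfolding qform_carrier[OF assms(1)] qform_carrier[OF tX] cnj_sum
    using assms by (subst sum.swap) (intro sum.cong refl, simp add: mult_ac)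
qed

text \<open>Transposition conjugates the form, so the skew part has the purely imaginary form \<i>
  Im.\<close>

lemma cmod_qform_skew_part:
  assumes "X \<in> carrier_mat n n"
  shows "cmod (qform (skew_part X) x) = \<bar>Im (qform X x)\<bar>"
proof -
  have "skew_part X = (1/2) \<cdot>\<^sub>m (X + (- 1) \<cdot>\<^sub>m transpose_mat X)"
    using assms unfolding skew_part_def by (intro arg_cong2[of _ _ _ _ "(\<cdot>\<^sub>m)"] eq_matI) auto
  then have "qform (skew_part X) x = of_real (1/2) * (qform X x + of_real (- 1) * cnj (qform X x))"
    using assms by (simp only: qform_add[of _ n] qform_smult[of _ n] qform_transpose[of _ n]
        smult_carrier_mat add_carrier_mat transpose_carrier_mat)
  also have "\<dots> = of_real (Im (qform X x)) * \<i>" by (simp add: complex_eq_iff)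
  finally show ?thesis by (simp add: norm_mult)
qed

lemma form_bounded_add:
  assumes "X \<in> carrier_mat n n" "Y \<in> carrier_mat n n" "R \<in> carrier_mat n n" "R' \<in> carrier_mat n n"
    and "form_bounded c X R" "form_bounded c Y R'"
  shows "form_bounded c (X + Y) (R + R')"
  unfolding form_bounded_def
proof
  fix x
  have "\<bar>Im (qform X x + qform Y x)\<bar> \<le> \<bar>Im (qform X x)\<bar> + \<bar>Im (qform Y x)\<bar>" by simp
  also have "\<dots> \<le> c * Re (qform R x) + c * Re (qform R' x)"
    using assms(5,6) by (intro add_mono) (auto simp: form_bounded_def)
  finally show "\<bar>Im (qform (X + Y) x)\<bar> \<le> c * Re (qform (R + R') x)"
    using assms(1-4) by (simp add: qform_add[of _ n] distrib_left)
qed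

lemma form_bounded_smult:
  assumes "X \<in> carrier_mat n n" "R \<in> carrier_mat n n" "0 \<le> e" "form_bounded c X R"
  shows "form_bounded c (e \<cdot>\<^sub>m X) (e \<cdot>\<^sub>m R)"
  unfolding form_bounded_def
proof
  fix x
  have "e * \<bar>Im (qform X x)\<bar> \<le> e * (c * Re (qform R x))"
    using assms(3,4) by (intro mult_left_mono) (auto simp: form_bounded_def)
  then show "\<bar>Im (qform (e \<cdot>\<^sub>m X) x)\<bar> \<le> c * Re (qform (e \<cdot>\<^sub>m R) x)"
    using assms(1-3) by (simp add: qform_smult[of _ n] abs_mult mult_ac)
qed

lemma form_bounded_mono:
  assumes "form_bounded c X R" "form_nonneg R" "c \<le> c'"
  shows "form_bounded c' X R"
  using assms unfolding form_bounded_def form_nonneg_def by (meson mult_right_mono order_trans)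

lemma form_bounded_symmetric:
  assumes "X \<in> carrier_mat n n" "transpose_mat X = X" "form_nonneg X" "0 \<le> c"
  shows "form_bounded c X X"
  unfolding form_bounded_def
proof
  fix x
  have "cnj (qform X x) = qform X x" using qform_transpose[OF assms(1), of x] assms(2) by simp
  then have "Im (qform X x) = 0" by (simp add: complex_eq_iff)
  then show "\<bar>Im (qform X x)\<bar> \<le> c * Re (qform X x)"
    using assms(3,4) by (simp add: form_nonneg_def)
qed

lemma qform_diag_by:
  assumes "sym_invol n U"
  shows "qform (diag_by n U d) x = (\<Sum>k<n. of_real (d k * (cmod (\<Sum>i<n. of_real (U $$ (k, i)) * x i))\<^sup>2))"
proof -
  have D: "diag_by n U d \<in> carrier_mat n n" using assms by (simp add: sym_invol_def)
  have "qform (diag_by n U d) x = (\<Sum>i<n. \<Sum>j<n. of_real (diag_by n U d $$ (i, j)) * (cnj (x i) * x j))"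
    unfolding qform_carrier[OF D] by (intro sum.cong refl) (simp add: mult_ac)
  also have "\<dots> = (\<Sum>k<n. of_real (d k) * (\<Sum>i<n. of_real (U $$ (k, i)) * cnj (x i)) * (\<Sum>j<n. of_real (U $$ (k, j)) * x j))"
    by (rule gram_sum[OF assms, symmetric])
  also have "\<dots> = (\<Sum>k<n. of_real (d k * (cmod (\<Sum>i<n. of_real (U $$ (k, i)) * x i))\<^sup>2))"
  proof (intro sum.cong refl)
    fix k
    have "(\<Sum>i<n. of_real (U $$ (k, i)) * cnj (x i)) = cnj (\<Sum>i<n. of_real (U $$ (k, i)) * x i)"
      by (simp add: cnj_sum)
    then show "of_real (d k) * (\<Sum>i<n. of_real (U $$ (k, i)) * cnj (x i)) * (\<Sum>j<n. of_real (U $$ (k, j)) * x j) =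
      of_real (d k * (cmod (\<Sum>i<n. of_real (U $$ (k, i)) * x i))\<^sup>2)"
      by (simp only: of_real_mult complex_norm_square mult_ac)
  qed
  finally show ?thesis .
qed

lemma form_nonneg_diag_by:
  assumes "sym_invol n U" "\<And>k. k < n \<Longrightarrow> 0 \<le> d k"
  shows "form_nonneg (diag_by n U d)"
  unfolding form_nonneg_def qform_diag_by[OF assms(1)] using assms(2)
  by (auto simp flip: of_real_sum intro!: sum_nonneg)

lemma sym_invol_orthonormal:
  assumes "sym_invol n U" "k < n" "l < n"
  shows "(\<Sum>i<n. U $$ (k, i) * U $$ (i, l)) = of_bool (k = l)"
proof -
  have U: "U \<in> carrier_mat n n" "U * U = 1\<^sub>m n" using assms by (auto simp: sym_invol_def)
  show ?thesis using mult_mat_entry[OF U(1,1) assms(2,3), symmetric] assms(2,3) U(2) by simp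
qed

text \<open>The columns of U are orthonormal eigenvectors, so the form at column l is exactly d
  l.\<close>

lemma diag_by_nonneg:
  assumes "sym_invol n U" "form_nonneg (diag_by n U d)" "l < n"
  shows "0 \<le> d l"
proof -
  have "0 \<le> Re (qform (diag_by n U d) (\<lambda>i. of_real (U $$ (i, l))))"
    using assms(2) by (simp add: form_nonneg_def)
  also have "\<dots> = (\<Sum>k<n. if k = l then d l else 0)"
    unfolding qform_diag_by[OF assms(1)] Re_sum
  proof (intro sum.cong refl)
    fix k assume "k \<in> {..<n}"
    then have "(\<Sum>i<n. U $$ (k, i) * U $$ (i, l)) = of_bool (k = l)"
      using sym_invol_orthonormal[OF assms(1) _ assms(3)] by simp
    then have "(\<Sum>i<n. complex_of_real (U $$ (k, i)) * of_real (U $$ (i, l))) = of_real (of_bool (k = l))"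
      by (simp flip: of_real_mult of_real_sum)
    then show "Re (of_real (d k * (cmod (\<Sum>i<n. of_real (U $$ (k, i)) * of_real (U $$ (i, l))))\<^sup>2)) = (if k = l then d l else 0)"
      by simp
  qed
  finally show ?thesis using assms(3) by simp
qed

lemma spd_diag_by:
  assumes U: "sym_invol n U" and d: "\<And>k. k < n \<Longrightarrow> 0 < d k"
  shows "spd (diag_by n U d)"
proof -
  have Uc: "U \<in> carrier_mat n n" "U * U = 1\<^sub>m n" using U by (auto simp: sym_invol_def)
  have D: "diag_by n U d \<in> carrier_mat n n" using Uc by simp
  have "0 < scalar_prod v (diag_by n U d *\<^sub>v v)" if v: "v \<in> carrier_vec n" "v \<noteq> 0\<^sub>v n" for v
  proof -
    let ?w = "\<lambda>k. \<Sum>i<n. U $$ (k, i) * v $ i"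
    have "scalar_prod v (diag_by n U d *\<^sub>v v) = (\<Sum>i<n. v $ i * (\<Sum>j<n. diag_by n U d $$ (i, j) * v $ j))"
      using D v by (simp add: scalar_prod_def lessThan_atLeast0 mult_mat_vec_def)
    also have "\<dots> = (\<Sum>i<n. \<Sum>j<n. diag_by n U d $$ (i, j) * (v $ i * v $ j))"
      by (simp add: sum_distrib_left mult_ac)
    also have "\<dots> = (\<Sum>k<n. d k * ?w k * ?w k)"
      using gram_sum[OF U, of d "\<lambda>i. v $ i" "\<lambda>i. v $ i"] by simp
    finally have eq: "scalar_prod v (diag_by n U d *\<^sub>v v) = (\<Sum>k<n. d k * ?w k * ?w k)" .
    have "\<exists>k<n. ?w k \<noteq> 0"
    proof (rule ccontr)
      assume "\<not> (\<exists>k<n. ?w k \<noteq> 0)"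
      then have "U *\<^sub>v v = 0\<^sub>v n"
        using Uc v by (intro eq_vecI) (auto simp: scalar_prod_def lessThan_atLeast0)
      then have "(U * U) *\<^sub>v v = U *\<^sub>v 0\<^sub>v n"
        using assoc_mult_mat_vec[OF Uc(1) Uc(1) v(1)] by simp
      also have "\<dots> = 0\<^sub>v n" using Uc(1) by (intro eq_vecI) auto
      finally show False using Uc(2) v by simp
    qed
    then obtain k where k: "k < n" "?w k \<noteq> 0" by blast
    have "0 < (\<Sum>k<n. d k * (?w k * ?w k))"
    proof (rule sum_pos2[of _ k])
      show "0 < d k * (?w k * ?w k)"
        using mult_pos_pos[OF d[OF k(1)]] k(2) not_real_square_gt_zero by blast
      show "0 \<le> d i * (?w i * ?w i)" if "i \<in> {..<n}" for i
        using that d[of i] by (intro mult_nonneg_nonneg zero_le_square) auto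
    qed (use k in auto)
    then show ?thesis unfolding eq by (simp add: mult.assoc)
  qed
  then show ?thesis
    using D transpose_diag_by[OF U, of d] unfolding spd_def by (auto simp: square_mat.simps)
qed

section \<open>Uniqueness and computation of the square root\<close>

lemma trace_mult_comm:
  fixes A B :: "real mat"
  assumes "A \<in> carrier_mat n n" "B \<in> carrier_mat n n"
  shows "(\<Sum>i<n. (A * B) $$ (i, i)) = (\<Sum>i<n. (B * A) $$ (i, i))"
proof -
  have "(\<Sum>i<n. (A * B) $$ (i, i)) = (\<Sum>i<n. \<Sum>l<n. A $$ (i, l) * B $$ (l, i))"
    by (intro sum.cong refl) (simp add: mult_mat_entry[OF assms])
  also have "\<dots> = (\<Sum>l<n. \<Sum>i<n. A $$ (i, l) * B $$ (l, i))"
    by (rule sum.swap)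
  also have "\<dots> = (\<Sum>i<n. (B * A) $$ (i, i))"
    by (intro sum.cong refl) (simp add: mult_mat_entry[OF assms(2,1)] mult.commute)
  finally show ?thesis .
qed

text \<open>With D = Q - R we have Q D + D R = 0; multiplying by D and taking traces,
  the nonnegative numbers tr (D Q D) and tr (D R D) add up to 0.\<close>

lemma spd_sqrt_unique:
  assumes Q: "spd Q" "Q \<in> carrier_mat n n" and R: "spd R" "R \<in> carrier_mat n n" and eq: "Q * Q = R * R"
  shows "Q = R"
proof -
  define D where "D = Q - R"
  have D: "D \<in> carrier_mat n n" using Q R by (simp add: D_def minus_carrier_mat)
  have Ds: "transpose_mat D = D" using Q R by (auto simp: D_def spd_def transpose_minus)
  have QD: "Q * D = Q * Q - Q * R" and DR: "D * R = Q * R - R * R"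
    unfolding D_def using Q R by (auto intro!: mult_minus_distrib_mat minus_mult_distrib_mat)
  have z: "Q * D + D * R = 0\<^sub>m n n"
    unfolding QD DR eq using Q R by (intro eq_matI) auto
  have entry: "(D * (X * D)) $$ (i, i) = scalar_prod (col D i) (X *\<^sub>v col D i)"
    if "X \<in> carrier_mat n n" "i < n" for X i
  proof -
    have "row D i = col D i" using that D Ds by (metis carrier_matD(1) col_transpose)
    then show ?thesis using that D by (simp add: mult_mat_vec_def)
  qed
  have "(\<Sum>i<n. (D * (Q * D)) $$ (i, i)) + (\<Sum>i<n. (D * (R * D)) $$ (i, i)) =
      (\<Sum>i<n. (D * (Q * D)) $$ (i, i)) + (\<Sum>i<n. (D * (D * R)) $$ (i, i))"
    using trace_mult_comm[of D n "D * R"] D R by (simp add: assoc_mult_mat[of _ n n _ n _ n])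
  also have "\<dots> = (\<Sum>i<n. (D * (Q * D + D * R)) $$ (i, i))"
    using D Q R by (simp add: mult_add_distrib_mat[of _ n n _ n] sum.distrib)
  also have "\<dots> = 0" using D by (simp add: z)
  finally have sum0: "(\<Sum>i<n. scalar_prod (col D i) (Q *\<^sub>v col D i) + scalar_prod (col D i) (R *\<^sub>v col D i)) = 0"
    using entry Q R by (simp add: sum.distrib)
  have nonneg: "0 \<le> scalar_prod (col D i) (X *\<^sub>v col D i)" if "spd X" "X \<in> carrier_mat n n" "i < n" for X i
  proof (cases "col D i = 0\<^sub>v n")
    case True
    then show ?thesis using that D by (simp add: scalar_prod_left_zero[of _ n])
  next
    case False
    then have "0 < scalar_prod (col D i) (X *\<^sub>v col D i)" using that D by (auto simp: spd_def)
    then show ?thesis by simp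
  qed
  have "col D i = 0\<^sub>v n" if i: "i < n" for i
  proof (rule ccontr)
    assume "col D i \<noteq> 0\<^sub>v n"
    then have "0 < scalar_prod (col D i) (Q *\<^sub>v col D i)" using Q D i by (auto simp: spd_def)
    moreover have "scalar_prod (col D i) (Q *\<^sub>v col D i) + scalar_prod (col D i) (R *\<^sub>v col D i) = 0"
      using sum0 i nonneg[OF Q] nonneg[OF R] by (subst (asm) sum_nonneg_eq_0_iff) auto
    ultimately show False using nonneg[OF R i] by simp
  qed
  then have D0: "D $$ (i, j) = 0" if "i < n" "j < n" for i j
    using that D by (metis carrier_matD index_col index_zero_vec(1))
  show ?thesis
  proof (rule eq_matI)
    fix i j assume "i < dim_row R" "j < dim_col R"
    then show "Q $$ (i, j) = R $$ (i, j)" using D0[of i j] Q R by (simp add: D_def)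
  qed (use Q R in auto)
qed

text \<open>The definite description needs both halves: square roots of the eigenvalues give
  existence, and \<open>spd_sqrt_unique\<close> excludes any other candidate.\<close>

lemma spd_sqrt_diag_by:
  assumes U: "sym_invol n U" and d: "\<And>k. k < n \<Longrightarrow> 0 < d k"
  shows "spd_sqrt (diag_by n U d) = diag_by n U (\<lambda>k. sqrt (d k))"
  unfolding spd_sqrt_def
proof (rule the_equality)
  have Uc: "U \<in> carrier_mat n n" using U by (simp add: sym_invol_def)
  let ?Q = "diag_by n U (\<lambda>k. sqrt (d k))"
  have "mat_diag n (\<lambda>k. sqrt (d k) * sqrt (d k)) = mat_diag n d"
  proof (intro eq_matI)
    fix i j assume "i < dim_row (mat_diag n d)" "j < dim_col (mat_diag n d)"
    then have ij: "i < n" "j < n" by (simp_all add: mat_diag_def)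
    have "sqrt (d j) * sqrt (d j) = d j" using d[OF ij(2)] by simp
    then show "mat_diag n (\<lambda>k. sqrt (d k) * sqrt (d k)) $$ (i, j) = mat_diag n d $$ (i, j)"
      using ij unfolding mat_diag_def by (simp only: index_mat prod.case)
  qed (simp_all add: mat_diag_def)
  then have QQ: "?Q * ?Q = diag_by n U d"
    unfolding diag_by_mult[OF U] by (simp add: diag_by_def)
  show Q: "spd ?Q \<and> ?Q * ?Q = diag_by n U d"
  proof (intro conjI QQ spd_diag_by[OF U])
    show "0 < sqrt (d k)" if "k < n" for k using d[OF that] by simp
  qed
  fix R assume R: "spd R \<and> R * R = diag_by n U d"
  \<comment> \<open>A competing root comes without a given size; it is read off from R * R.\<close>
  have "dim_row R = dim_row (R * R)" by simp
  also have "\<dots> = dim_row (diag_by n U d)" by (rule arg_cong[of _ _ dim_row]) (rule conjunct2[OF R])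
  also have "\<dots> = n" by (rule carrier_matD(1)[OF diag_by_carrier[OF Uc]])
  finally have r: "dim_row R = n" .
  have "square_mat R" using conjunct1[OF R] unfolding spd_def by (rule conjunct1)
  then have "R \<in> carrier_mat n n" using r by (intro carrier_matI) auto
  moreover have "R * R = ?Q * ?Q" using R QQ by (simp only:)
  ultimately show "R = ?Q"
    using spd_sqrt_unique[of R n ?Q] conjunct1[OF R] conjunct1[OF Q] diag_by_carrier[OF Uc] by blast
qed

lemma inv_sqrt_mat_diag_by:
  assumes U: "sym_invol n U" and d: "\<And>k. k < n \<Longrightarrow> 0 < d k"
  shows "inv_sqrt_mat (diag_by n U d) = diag_by n U (\<lambda>k. 1 / sqrt (d k))"
proof -
  have Uc: "U \<in> carrier_mat n n" using U by (simp add: sym_invol_def)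
  define Q where "Q = diag_by n U (\<lambda>k. sqrt (d k))"
  define W where "W = diag_by n U (\<lambda>k. 1 / sqrt (d k))"
  have Qc: "Q \<in> carrier_mat n n" and Wc: "W \<in> carrier_mat n n" using Uc by (auto simp: Q_def W_def)
  have "mat_diag n (\<lambda>k. sqrt (d k) * (1 / sqrt (d k))) = mat_diag n (\<lambda>k. 1)"
    "mat_diag n (\<lambda>k. 1 / sqrt (d k) * sqrt (d k)) = mat_diag n (\<lambda>k. 1)"
    using d by (intro eq_matI; fastforce simp: mat_diag_def)+
  then have QW: "Q * W = 1\<^sub>m n" and WQ: "W * Q = 1\<^sub>m n"
    unfolding Q_def W_def diag_by_mult[OF U] diag_by_one[OF U, symmetric] by (simp_all add: diag_by_def)
  \<comment> \<open>The explicit inverse W excludes the result None, and uniqueness of inverses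
    identifies any other result with W.\<close>
  have "mat_inverse Q = Some W"
  proof (cases "mat_inverse Q")
    case None
    from mat_inverse(1)[OF Qc this, of "undefined"] have False
      using Qc Wc QW WQ by (auto simp: Units_def ring_mat_def)
    then show ?thesis ..
  next
    case (Some B)
    from mat_inverse(2)[OF Qc this] have B: "Q * B = 1\<^sub>m n" "B * Q = 1\<^sub>m n" "B \<in> carrier_mat n n" by auto
    have "B = B * (Q * W)" using B QW by simp
    also have "\<dots> = W" using B Qc Wc by (simp add: assoc_mult_mat[of _ n n _ n _ n, symmetric])
    finally show ?thesis using Some by simp
  qed
  moreover have "spd_sqrt (diag_by n U d) = Q"
    unfolding Q_def by (rule spd_sqrt_diag_by[OF U d])
  ultimately show ?thesis by (simp add: inv_sqrt_mat_def W_def)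
qed

lemma qform_congruence:
  assumes R: "R \<in> carrier_mat n n" "transpose_mat R = R" and S: "S \<in> carrier_mat n n"
  shows "qform (R * S * R) x = qform S (\<lambda>i. \<Sum>j<n. of_real (R $$ (i, j)) * x j)"
proof -
  have RS: "R * S \<in> carrier_mat n n" and RSR: "R * S * R \<in> carrier_mat n n" using R S by auto
  have sym: "R $$ (i, j) = R $$ (j, i)" if "i < n" "j < n" for i j
    using that R by (metis carrier_matD index_transpose_mat(1))
  let ?F = "\<lambda>k l i j. cnj (of_real (R $$ (k, i)) * x i) * of_real (S $$ (k, l)) * (of_real (R $$ (l, j)) * x j)"
  have "qform (R * S * R) x = (\<Sum>i<n. \<Sum>j<n. \<Sum>l<n. \<Sum>k<n. ?F k l i j)"
    unfolding qform_carrier[OF RSR]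
  proof (intro sum.cong refl)
    fix i j assume ij: "i \<in> {..<n}" "j \<in> {..<n}"
    have "(R * S * R) $$ (i, j) = (\<Sum>l<n. \<Sum>k<n. R $$ (k, i) * S $$ (k, l) * R $$ (l, j))"
      using ij by (subst mult_mat_entry[OF RS R(1)])
        (auto simp: mult_mat_entry[OF R(1) S] sum_distrib_right sym[of i] intro!: sum.cong)
    then show "cnj (x i) * of_real ((R * S * R) $$ (i, j)) * x j = (\<Sum>l<n. \<Sum>k<n. ?F k l i j)"
      by (simp add: sum_distrib_left sum_distrib_right mult_ac)
  qed
  also have "\<dots> = (\<Sum>i<n. \<Sum>l<n. \<Sum>j<n. \<Sum>k<n. ?F k l i j)"
    by (intro sum.cong refl sum.swap)
  also have "\<dots> = (\<Sum>i<n. \<Sum>l<n. \<Sum>k<n. \<Sum>j<n. ?F k l i j)"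
    by (intro sum.cong refl sum.swap)
  also have "\<dots> = (\<Sum>i<n. \<Sum>k<n. \<Sum>l<n. \<Sum>j<n. ?F k l i j)"
    by (intro sum.cong refl sum.swap)
  also have "\<dots> = (\<Sum>k<n. \<Sum>i<n. \<Sum>l<n. \<Sum>j<n. ?F k l i j)"
    by (rule sum.swap)
  also have "\<dots> = (\<Sum>k<n. \<Sum>l<n. \<Sum>i<n. \<Sum>j<n. ?F k l i j)"
    by (intro sum.cong refl sum.swap)
  also have "\<dots> = qform S (\<lambda>i. \<Sum>j<n. of_real (R $$ (i, j)) * x j)"
    unfolding qform_carrier[OF S] cnj_sum mult.assoc
    by (intro sum.cong refl, subst sum.swap) (simp add: sum_distrib_left sum_distrib_right mult_ac)
  finally show ?thesis .
qed

lemma qform_one: "qform (1\<^sub>m n) x = of_real (\<Sum>i<n. (cmod (x i))\<^sup>2)"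
proof -
  have "qform (1\<^sub>m n) x = (\<Sum>i<n. \<Sum>j<n. if j = i then cnj (x i) * x i else 0)"
    unfolding qform_carrier[OF one_carrier_mat] by (intro sum.cong refl) auto
  also have "\<dots> = (\<Sum>i<n. x i * cnj (x i))" by (simp add: mult.commute)
  also have "\<dots> = (\<Sum>i<n. of_real ((cmod (x i))\<^sup>2))" by (simp only: complex_norm_square)
  finally show ?thesis by simp
qed

lemma spectral_radius_preconditioned_le:
  assumes U: "sym_invol n U" and d: "\<And>k. k < n \<Longrightarrow> 0 < d k" and n: "0 < n"
    and C: "C \<in> carrier_mat n n" and b: "form_bounded c C (diag_by n U d)"
  defines "W \<equiv> inv_sqrt_mat (diag_by n U d)"
  shows "spectral_radius (map_mat complex_of_real (W * skew_part C * W)) \<le> c"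
proof -
  define S where "S = skew_part C"
  have S: "S \<in> carrier_mat n n" using C by (simp add: S_def)
  have Uc: "U \<in> carrier_mat n n" using U by (simp add: sym_invol_def)
  have Weq: "W = diag_by n U (\<lambda>k. 1 / sqrt (d k))" unfolding W_def by (rule inv_sqrt_mat_diag_by[OF U d])
  have W: "W \<in> carrier_mat n n" "transpose_mat W = W"
    using Uc transpose_diag_by[OF U] by (auto simp: Weq)
  have "mat_diag n (\<lambda>k. 1 / sqrt (d k) * d k * (1 / sqrt (d k))) = mat_diag n (\<lambda>k. 1)"
  proof (intro eq_matI)
    fix i j assume "i < dim_row (mat_diag n (\<lambda>k. 1 :: real))" "j < dim_col (mat_diag n (\<lambda>k. 1 :: real))"
    then show "mat_diag n (\<lambda>k. 1 / sqrt (d k) * d k * (1 / sqrt (d k))) $$ (i, j) = mat_diag n (\<lambda>k. 1) $$ (i, j)"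
      using d[of j] by (auto simp: mat_diag_def)
  qed (auto simp: mat_diag_def)
  then have WPW: "W * diag_by n U d * W = 1\<^sub>m n"
    unfolding Weq diag_by_mult[OF U] diag_by_one[OF U, symmetric] by (simp add: diag_by_def)
  let ?M = "map_mat complex_of_real (W * S * W)"
  have WSW: "W * S * W \<in> carrier_mat n n" using W S by auto
  have M: "?M \<in> carrier_mat n n" using WSW by simp
  have "cmod l \<le> c" if l: "l \<in> spectrum ?M" for l
  proof -
    obtain v where v: "v \<in> carrier_vec n" "v \<noteq> 0\<^sub>v n" "?M *\<^sub>v v = l \<cdot>\<^sub>v v"
    proof -
      obtain v where "eigenvector ?M v l"
        using l by (auto simp only: spectrum_def eigenvalue_def mem_Collect_eq)
      then have "v \<in> carrier_vec n \<and> v \<noteq> 0\<^sub>v n \<and> ?M *\<^sub>v v = l \<cdot>\<^sub>v v"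
        unfolding eigenvector_def carrier_matD(1)[OF M] .
      then show ?thesis using that by blast
    qed
    define x where "x i = v $ i" for i
    define y where "y i = (\<Sum>j<n. of_real (W $$ (i, j)) * x j)" for i
    define N where "N = (\<Sum>i<n. (cmod (x i))\<^sup>2)"
    have "\<exists>i<n. x i \<noteq> 0"
    proof (rule ccontr)
      assume "\<not> (\<exists>i<n. x i \<noteq> 0)"
      then have "v = 0\<^sub>v n" using v(1) by (intro eq_vecI) (auto simp: x_def)
      with v(2) show False by simp
    qed
    then obtain i where i: "i < n" "x i \<noteq> 0" by blast
    have N: "0 < N" unfolding N_def
      by (rule sum_pos2[of _ i]) (use i in auto)
    have row: "(\<Sum>j<n. of_real ((W * S * W) $$ (i, j)) * x j) = l * x i" if "i < n" for i
    proof -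
      have "(?M *\<^sub>v v) $ i = (\<Sum>j<n. of_real ((W * S * W) $$ (i, j)) * x j)"
        using that W(1) S v(1) by (simp add: scalar_prod_def lessThan_atLeast0 x_def)
      then show ?thesis using v that by (simp add: x_def)
    qed
    have "qform (W * S * W) x = (\<Sum>i<n. cnj (x i) * (\<Sum>j<n. of_real ((W * S * W) $$ (i, j)) * x j))"
      unfolding qform_carrier[OF WSW] sum_distrib_left mult.assoc ..
    also have "\<dots> = (\<Sum>i<n. cnj (x i) * (l * x i))"
      using row by (intro sum.cong refl arg_cong[of _ _ "(*) _"]) auto
    also have "\<dots> = l * of_real N"
    proof -
      have "cnj (x i) * (l * x i) = l * of_real ((cmod (x i))\<^sup>2)" for i
        by (simp only: complex_norm_square mult_ac)
      then show ?thesis by (simp only: N_def of_real_sum sum_distrib_left)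
    qed
    finally have 1: "qform S y = l * of_real N"
      using qform_congruence[OF W S, of x] by (simp add: y_def[abs_def])
    have 2: "qform (diag_by n U d) y = of_real N"
      using qform_congruence[OF W diag_by_carrier[OF Uc], of d x] unfolding WPW qform_one by (simp add: y_def[abs_def] N_def)
    have "cmod l * N = cmod (qform S y)" unfolding 1 using N by (simp add: norm_mult)
    also have "\<dots> \<le> c * Re (qform (diag_by n U d) y)"
      unfolding S_def cmod_qform_skew_part[OF C] using b by (simp add: form_bounded_def)
    also have "\<dots> = c * N" unfolding 2 by simp
    finally show ?thesis using N by simp
  qed
  \<comment> \<open>In positive dimension the spectrum is nonempty, so the spectral radius is the
    modulus of an eigenvalue, to which the bound applies.\<close>
  then show ?thesis
    using spectral_radius_mem_max(1)[OF M n] unfolding S_def by auto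
qed

section \<open>The coefficient matrix and its preconditioner\<close>

definition A_coeff :: "nat \<Rightarrow> real" where
  "A_coeff m = (if m = 0 then 6/8 else if m = 1 then 1/8 else 0)"

definition A_eigenvalue :: "nat \<Rightarrow> nat \<Rightarrow> real" where
  "A_eigenvalue n k = A_coeff 0 + 2 * (\<Sum>m = 1..n - 1. A_coeff m * cos (real m * real (k + 1) * pi / (real n + 1)))"

text \<open>All Hankel indices are at least 2, whereas the coefficients of a tridiagonal matrix
  vanish from 2 on. So A_n equals its own \<tau> matrix.\<close>

lemma A_mat_diag_by: "A_mat n = diag_by n (sine_mat n) (A_eigenvalue n)"
proof (rule eq_matI)
  have D: "diag_by n (sine_mat n) (A_eigenvalue n) \<in> carrier_mat n n" by simp
  show "dim_row (A_mat n) = dim_row (diag_by n (sine_mat n) (A_eigenvalue n))"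
    "dim_col (A_mat n) = dim_col (diag_by n (sine_mat n) (A_eigenvalue n))"
    unfolding carrier_matD[OF D] by (simp_all add: A_mat_def)
  fix i j assume "i < dim_row (diag_by n (sine_mat n) (A_eigenvalue n))"
    "j < dim_col (diag_by n (sine_mat n) (A_eigenvalue n))"
  then have ij: "i < n" "j < n" using D by auto
  have "diag_by n (sine_mat n) (A_eigenvalue n) $$ (i, j) = toeplitz_entry A_coeff n i j - hankel_entry A_coeff n i j"
    using sine_diag_sine_entry[OF ij, of A_coeff] by (simp only: diag_by_def A_eigenvalue_def[abs_def])
  also have "hankel_entry A_coeff n i j = 0"
    using ij by (auto simp: hankel_entry_conv A_coeff_def)
  also have "toeplitz_entry A_coeff n i j - 0 = A_mat n $$ (i, j)"
    using ij by (auto simp: toeplitz_entry_conv A_coeff_def A_mat_def)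
  finally show "A_mat n $$ (i, j) = diag_by n (sine_mat n) (A_eigenvalue n) $$ (i, j)" by simp
qed

text \<open>The cosine terms contribute at most 2/8 in modulus against the diagonal 6/8.\<close>

lemma A_eigenvalue_pos: "0 < A_eigenvalue n k"
proof -
  have "\<bar>\<Sum>m = 1..n - 1. A_coeff m * cos (real m * real (k + 1) * pi / (real n + 1))\<bar> \<le>
      (\<Sum>m = 1..n - 1. \<bar>A_coeff m * cos (real m * real (k + 1) * pi / (real n + 1))\<bar>)"
    by (rule sum_abs)
  also have "\<dots> \<le> (\<Sum>m = 1..n - 1. if m = 1 then 1/8 else 0)"
    by (intro sum_mono) (auto simp: A_coeff_def abs_mult)
  also have "\<dots> \<le> 1/8" by simp
  finally show ?thesis by (simp add: A_eigenvalue_def A_coeff_def)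
qed

lemma eta_pos:
  assumes "0 < \<delta> i" "a i < b i" "0 < T" "0 < M"
  shows "0 < eta \<delta> a b n T M i"
proof -
  have "0 < step_size a b n i" using assms by (simp add: step_size_def)
  then show ?thesis using assms unfolding eta_def
    by (intro divide_pos_pos mult_pos_pos Gamma_real_pos) auto
qed

lemma varsigma_bounds:
  assumes "\<And>i. i \<in> {1..3::nat} \<Longrightarrow> 0 < \<delta> i \<and> \<delta> i < 1" "\<And>i. i \<in> {1..3::nat} \<Longrightarrow> 0 < kp i \<and> 0 < km i"
  shows "0 \<le> varsigma \<delta> kp km"
    and "i \<in> {1..3} \<Longrightarrow> 3/2 * (tan (\<delta> i / 2 * pi) * (\<bar>kp i - km i\<bar> / (kp i + km i))) \<le> varsigma \<delta> kp km"
proof -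
  let ?f = "\<lambda>i. tan (\<delta> i / 2 * pi) * (\<bar>kp i - km i\<bar> / (kp i + km i))"
  have le: "?f i \<le> Max (?f ` {1..3})" if "i \<in> {1..3}" for i
    using that by (intro Max_ge) auto
  then show "i \<in> {1..3} \<Longrightarrow> 3/2 * ?f i \<le> varsigma \<delta> kp km"
    unfolding varsigma_def by (intro mult_left_mono) auto
  have "0 < tan (\<delta> 1 / 2 * pi)" using assms(1)[of 1] by (intro tan_gt_zero) auto
  then have "0 \<le> ?f 1" using assms(2)[of 1] by (intro mult_nonneg_nonneg divide_nonneg_nonneg) auto
  also have "?f 1 \<le> Max (?f ` {1..3})" by (rule le) auto
  finally show "0 \<le> varsigma \<delta> kp km" by (simp add: varsigma_def)
qed

theorem lemma3p10:
  fixes \<delta> a b kp km :: "nat \<Rightarrow> real" and n :: "nat \<Rightarrow> nat" and T :: real and M :: nat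
  assumes "\<And>i. i \<in> {1..3} \<Longrightarrow> 0 < \<delta> i \<and> \<delta> i < 1"
    and "\<And>i. i \<in> {1..3} \<Longrightarrow> a i < b i"
    and "\<And>i. i \<in> {1..3} \<Longrightarrow> 0 < kp i \<and> 0 < km i"
    and "\<And>i. i \<in> {1..3} \<Longrightarrow> 0 < n i"
    and "0 < T" and "0 < M"
  shows "spectral_radius (map_mat complex_of_real
           (inv_sqrt_mat (precond_mat \<delta> a b kp km n T M)
            * skew_part (coeff_mat \<delta> a b kp km n T M)
            * inv_sqrt_mat (precond_mat \<delta> a b kp km n T M)))
         \<le> varsigma \<delta> kp km
       \<and> 0 \<le> varsigma \<delta> kp km"
proof -
  define c where "c = varsigma \<delta> kp km"
  define A where "A i = A_mat (n i)" for i
  define B where "B i = B_mat (kp i) (km i) (\<delta> i) (n i)" for i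
  define R where "R i = tau_mat (sym_part (B i))" for i
  define S where "S i = sine_mat (n i)" for i
  define l where "l i = A_eigenvalue (n i)" for i
  define \<eta> where "\<eta> = eta \<delta> a b n T M"
  have c0: "0 \<le> c" unfolding c_def by (rule varsigma_bounds(1)[OF assms(1,3)])
  have S: "sym_invol (n i) (S i)" for i unfolding S_def by (rule sym_invol_sine_mat)
  have Sc: "S i \<in> carrier_mat (n i) (n i)" for i by (simp add: S_def)
  have A: "A i = diag_by (n i) (S i) (l i)" for i by (simp add: A_def S_def l_def A_mat_diag_by)
  have Ac: "A i \<in> carrier_mat (n i) (n i)" for i by (simp add: A Sc)
  have Bc: "B i \<in> carrier_mat (n i) (n i)" for i by (simp add: B_def)
  have Rc: "R i \<in> carrier_mat (n i) (n i)" for i by (simp add: R_def B_def)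
  have l: "0 < l i k" for i k by (simp add: l_def A_eigenvalue_pos)
  have eta: "0 < \<eta> i" if "i \<in> {1..3}" for i
    unfolding \<eta>_def using assms that by (intro eta_pos) auto
  have R0: "form_nonneg (R i)" if "i \<in> {1..3}" for i
    unfolding R_def B_def using assms(1)[OF that] assms(3)[OF that] by (intro form_nonneg_tau_B_mat) auto
  \<comment> \<open>The three directions have different constants; nonnegativity of the \<tau> forms
    lets all of them be raised to the common maximum.\<close>
  have BR: "form_bounded c (B i) (R i)" if "i \<in> {1..3}" for i
  proof (rule form_bounded_mono[OF _ R0[OF that]])
    show "3/2 * (tan (\<delta> i / 2 * pi) * (\<bar>kp i - km i\<bar> / (kp i + km i))) \<le> c"
      unfolding c_def by (rule varsigma_bounds(2)[OF assms(1,3) that])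
    show "form_bounded (3/2 * (tan (\<delta> i / 2 * pi) * (\<bar>kp i - km i\<bar> / (kp i + km i)))) (B i) (R i)"
      unfolding R_def B_def using assms(1)[OF that] assms(3)[OF that] by (intro form_bounded_B_mat) auto
  qed
  \<comment> \<open>The cosine formula for the eigenvalues does not show their sign; it is recovered
    from the nonnegative form.\<close>
  have "\<exists>\<mu>. \<forall>i\<in>{1..3}. R i = diag_by (n i) (S i) (\<mu> i) \<and> (\<forall>k<n i. 0 \<le> \<mu> i k)"
  proof -
    have "\<exists>m. R i = diag_by (n i) (S i) m \<and> (\<forall>k<n i. 0 \<le> m k)" if i: "i \<in> {1..3}" for i
    proof -
      obtain m where m: "R i = diag_by (n i) (S i) m"
        using tau_mat_sym_part_B_mat[OF assms(4)[OF i]] unfolding R_def B_def S_def diag_by_def by blast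
      then show ?thesis using diag_by_nonneg[OF S, of i m] R0[OF i] by auto
    qed
    then show ?thesis by metis
  qed
  then obtain \<mu> where R: "\<And>i. i \<in> {1..3} \<Longrightarrow> R i = diag_by (n i) (S i) (\<mu> i)"
    and \<mu>: "\<And>i k. i \<in> {1..3} \<Longrightarrow> k < n i \<Longrightarrow> 0 \<le> \<mu> i k" by blast
  define N where "N = n 3 * n 2 * n 1"
  define U where "U = S 3 \<otimes>\<^sub>K S 2 \<otimes>\<^sub>K S 1"
  \<comment> \<open>The product nests to the left, so the lowest digit of k belongs to direction 1
    and the highest to direction 3.\<close>
  define ev where "ev u v w k = u (k div n 1 div n 2) * v (k div n 1 mod n 2) * (w (k mod n 1) :: real)" for u v w k
  have U: "sym_invol N U" unfolding U_def N_def by (intro sym_invol_kron S)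
  have Uc: "U \<in> carrier_mat N N" using U by (simp add: sym_invol_def)
  have K: "diag_by (n 3) (S 3) u \<otimes>\<^sub>K diag_by (n 2) (S 2) v \<otimes>\<^sub>K diag_by (n 1) (S 1) w = diag_by N U (ev u v w)" for u v w
    unfolding diag_by_kron[OF Sc Sc] diag_by_kron[OF kron_carrier[OF Sc Sc] Sc] N_def U_def ev_def[abs_def] ..
  define D where "D k = ev (l 3) (l 2) (l 1) k + \<eta> 1 * ev (l 3) (l 2) (\<mu> 1) k + \<eta> 2 * ev (l 3) (\<mu> 2) (l 1) k
    + \<eta> 3 * ev (\<mu> 3) (l 2) (l 1) k" for k
  have P: "precond_mat \<delta> a b kp km n T M = A 3 \<otimes>\<^sub>K A 2 \<otimes>\<^sub>K A 1 + \<eta> 1 \<cdot>\<^sub>m (A 3 \<otimes>\<^sub>K A 2 \<otimes>\<^sub>K R 1)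
      + \<eta> 2 \<cdot>\<^sub>m (A 3 \<otimes>\<^sub>K R 2 \<otimes>\<^sub>K A 1) + \<eta> 3 \<cdot>\<^sub>m (R 3 \<otimes>\<^sub>K A 2 \<otimes>\<^sub>K A 1)"
    by (simp add: precond_mat_def Let_def A_def R_def B_def \<eta>_def)
  have C: "coeff_mat \<delta> a b kp km n T M = A 3 \<otimes>\<^sub>K A 2 \<otimes>\<^sub>K A 1 + \<eta> 1 \<cdot>\<^sub>m (A 3 \<otimes>\<^sub>K A 2 \<otimes>\<^sub>K B 1)
      + \<eta> 2 \<cdot>\<^sub>m (A 3 \<otimes>\<^sub>K B 2 \<otimes>\<^sub>K A 1) + \<eta> 3 \<cdot>\<^sub>m (B 3 \<otimes>\<^sub>K A 2 \<otimes>\<^sub>K A 1)"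
    by (simp add: coeff_mat_def Let_def A_def B_def \<eta>_def)
  have R1: "R 1 = diag_by (n 1) (S 1) (\<mu> 1)" and R2: "R 2 = diag_by (n 2) (S 2) (\<mu> 2)"
    and R3: "R 3 = diag_by (n 3) (S 3) (\<mu> 3)" by (rule R; simp)+
  have PD: "precond_mat \<delta> a b kp km n T M = diag_by N U D"
    unfolding P A R1 R2 R3 K diag_by_smult[OF Uc] diag_by_add[OF Uc]
    by (rule arg_cong[of _ _ "diag_by N U"]) (simp add: D_def fun_eq_iff)
  have D: "0 < D k" if k: "k < N" for k
  proof -
    note b1 = div_mod_less[OF k[unfolded N_def]] and b2 = div_mod_less[OF div_mod_less(1)[OF k[unfolded N_def]]]
    \<comment> \<open>Strict positivity of P comes from this summand; the \<tau> terms contribute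
      only nonnegative amounts.\<close>
    have "0 < ev (l 3) (l 2) (l 1) k" unfolding ev_def by (intro mult_pos_pos l)
    moreover have "0 \<le> ev (l 3) (l 2) (\<mu> 1) k" "0 \<le> ev (l 3) (\<mu> 2) (l 1) k" "0 \<le> ev (\<mu> 3) (l 2) (l 1) k"
      unfolding ev_def by (intro mult_nonneg_nonneg less_imp_le[OF l] \<mu> b1 b2; simp)+
    moreover have "0 \<le> \<eta> 1" "0 \<le> \<eta> 2" "0 \<le> \<eta> 3" using eta[of 1] eta[of 2] eta[of 3] by auto
    ultimately show ?thesis unfolding D_def by (simp add: add_pos_nonneg)
  qed
  have N: "0 < N" unfolding N_def using assms(4)[of 1] assms(4)[of 2] assms(4)[of 3] by simp
  have cN: "X \<otimes>\<^sub>K Y \<otimes>\<^sub>K Z \<in> carrier_mat N N"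
    if "X \<in> carrier_mat (n 3) (n 3)" "Y \<in> carrier_mat (n 2) (n 2)" "Z \<in> carrier_mat (n 1) (n 1)" for X Y Z
    unfolding N_def by (intro kron_carrier that)
  have AA: "A 3 \<otimes>\<^sub>K A 2 = diag_by (n 3 * n 2) (S 3 \<otimes>\<^sub>K S 2) (\<lambda>i. l 3 (i div n 2) * l 2 (i mod n 2))"
    unfolding A by (rule diag_by_kron[OF Sc Sc])
  have AAA: "A 3 \<otimes>\<^sub>K A 2 \<otimes>\<^sub>K A 1 = diag_by N U (ev (l 3) (l 2) (l 1))"
    unfolding A K ..
  have F0: "form_bounded c (A 3 \<otimes>\<^sub>K A 2 \<otimes>\<^sub>K A 1) (A 3 \<otimes>\<^sub>K A 2 \<otimes>\<^sub>K A 1)"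
    unfolding AAA
  proof (rule form_bounded_symmetric[OF diag_by_carrier[OF Uc] transpose_diag_by[OF U] form_nonneg_diag_by[OF U] c0])
    show "0 \<le> ev (l 3) (l 2) (l 1) k" for k unfolding ev_def by (intro mult_nonneg_nonneg less_imp_le[OF l])
  qed
  have F1: "form_bounded c (A 3 \<otimes>\<^sub>K A 2 \<otimes>\<^sub>K B 1) (A 3 \<otimes>\<^sub>K A 2 \<otimes>\<^sub>K R 1)"
    unfolding AA by (rule form_bounded_kron(1)[OF sym_invol_kron[OF S S] _ Bc Rc BR]) (auto intro: mult_nonneg_nonneg less_imp_le[OF l])
  \<comment> \<open>With B in the middle the diagonalised factors lie on both sides: A 1 is peeled
    off from the right, then A 3 from the left.\<close>
  have F2: "form_bounded c (A 3 \<otimes>\<^sub>K B 2 \<otimes>\<^sub>K A 1) (A 3 \<otimes>\<^sub>K R 2 \<otimes>\<^sub>K A 1)"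
    unfolding A[of 1] 
    by (rule form_bounded_kron(2)[OF S _ kron_carrier[OF Ac Bc] kron_carrier[OF Ac Rc]], rule less_imp_le[OF l],
      unfold A, rule form_bounded_kron(1)[OF S _ Bc Rc BR], rule less_imp_le[OF l], simp)
  have F3: "form_bounded c (B 3 \<otimes>\<^sub>K A 2 \<otimes>\<^sub>K A 1) (R 3 \<otimes>\<^sub>K A 2 \<otimes>\<^sub>K A 1)"
    unfolding A[of 1]
    by (rule form_bounded_kron(2)[OF S _ kron_carrier[OF Bc Ac] kron_carrier[OF Rc Ac]], rule less_imp_le[OF l],
      unfold A, rule form_bounded_kron(2)[OF S _ Bc Rc BR], rule less_imp_le[OF l], simp)
  have Cc: "coeff_mat \<delta> a b kp km n T M \<in> carrier_mat N N"
    unfolding C by (intro add_carrier_mat smult_carrier_mat cN Ac Bc)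
  have "form_bounded c (coeff_mat \<delta> a b kp km n T M) (precond_mat \<delta> a b kp km n T M)"
    unfolding C P using eta[of 1] eta[of 2] eta[of 3]
    by (intro form_bounded_add[of _ N] form_bounded_smult[of _ N] add_carrier_mat smult_carrier_mat cN Ac Bc Rc F0 F1 F2 F3) auto
  then have "spectral_radius (map_mat complex_of_real (inv_sqrt_mat (diag_by N U D)
      * skew_part (coeff_mat \<delta> a b kp km n T M) * inv_sqrt_mat (diag_by N U D))) \<le> c"
    unfolding PD by (intro spectral_radius_preconditioned_le[OF U D N Cc])
  with c0 show ?thesis unfolding PD c_def by simp
qed

end
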